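(* Let $M$ be an invertible $3\times3$ complex matrix, and let $\mathcal{S}\subset\mathbb{C}^2$ be a smooth compact strongly $\mathbb{C}$-convex hypersurface that is $M$-admissible, bounding a domain $\Omega$. Equip $\mathcal{S}$ with the measure $|\nu_M|$ and write $L^2(\mathcal{S})=L^2(\mathcal{S},|\nu_M|)$. Let $\mathbf{R}_{\mathcal{S}}:L^2(\mathcal{S})\to W(\mathcal{S})$ be $f\mapsto\tau(\nu_M)\cdot\mathbf{P}_{\mathcal{S}}f$, and define $\mathbf{Q}_{\mathcal{S}}:W(\mathcal{S})\to H^2(\mathcal{S})$ by $f\mapsto\mathbf{L}_{\mathcal{S}}\big(\overline{\tau(\nu_M)}\cdot f\big)$. Then: (a) $\mathbf{L}_{\mathcal{S}}=\mathbf{Q}_{\mathcal{S}}\circ\mathbf{R}_{\mathcal{S}}$; (b) $\|\mathbf{L}_{\mathcal{S}}\|=\|\mathbf{Q}_{\mathcal{S}}\|$ (operator norms with respect to $L^2(\mathcal{S},|\nu_M|)$); (c) $\mathbf{Q}_{\mathcal{S}}$ is invertible.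
   Context: Write $M=\begin{pmatrix}c_1&a_1&a_2\\ b_1&m_{11}&m_{12}\\ b_2&m_{21}&m_{22}\end{pmatrix}$ and $\Phi_M((z_1,z_2),(w_1,w_2))=(1,w_1,w_2)\,M\,(1,z_1,z_2)^T$. For a smooth real hypersurface $\mathcal{S}\subset\mathbb{C}^2$ with defining function $\rho$ put $\mu_1=\partial\rho/\partial\zeta_2$, $\mu_2=-\partial\rho/\partial\zeta_1$. $\mathcal{S}$ is $M$-admissible if for all $\zeta\in\mathcal{S}$ $$\det\begin{pmatrix}m_{11}\mu_1(\zeta)+m_{12}\mu_2(\zeta)&m_{11}\zeta_1+m_{12}\zeta_2+b_1\\ m_{21}\mu_1(\zeta)+m_{22}\mu_2(\zeta)&m_{21}\zeta_1+m_{22}\zeta_2+b_2\end{pmatrix}\ne0.$$ Then $w_{1,M},w_{2,M}$ are the unique functions on $\mathcal{S}$ such that the complex tangent line to $\mathcal{S}$ at each $\zeta$ is $\{z:\Phi_M(z,(w_{1,M}(\zeta),w_{2,M}(\zeta)))=0\}$. Set $$\nu_M=\frac{1}{(2\pi i)^2}\left(\begin{pmatrix}dw_{1,M}&dw_{2,M}\end{pmatrix}\begin{pmatrix}m_{11}&m_{12}\\ m_{21}&m_{22}\end{pmatrix}\begin{pmatrix}a_2\\ -a_1\end{pmatrix}+\begin{vmatrix}m_{11}&m_{12}\\ m_{21}&m_{22}\end{vmatrix}(w_{2,M}dw_{1,M}-w_{1,M}dw_{2,M})\right)\wedge d\zeta_1\wedge d\zeta_2 .$$ On an $M$-admissible strongly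 $\mathbb{C}$-convex $\mathcal{S}$ this is a nowhere-vanishing 3-form on $\mathcal{S}$, so $\nu_M=\tau(\nu_M)\,|\nu_M|$ with $\tau(\nu_M)$ a unimodular function and $|\nu_M|$ a positive 3-form ($\mathcal{S}$ oriented as the boundary of $\Omega$), viewed as a measure. Strong $\mathbb{C}$-convexity: a connected smooth strongly pseudoconvex real hypersurface is strongly $\mathbb{C}$-convex if for each of its points $p$, after an automorphism of $\mathbb{C}\mathbb{P}^2$ moving $p$ to $0$ and putting the hypersurface near $0$ in the form $\operatorname{Im}\zeta_2=\alpha|\zeta_1|^2+\operatorname{Re}(b\zeta_1^2)+c(\operatorname{Re}\zeta_2)^2+O(\|(\zeta_1,\operatorname{Re}\zeta_2)\|^3)$ (always possible), the form $\alpha|\zeta_1|^2+\operatorname{Re}(b\zeta_1^2)$ is positive definite in $\zeta_1$. Leray transform: for $z\in\Omega$, $\mathbf{L}_{\mathcal{S}}f(z)=\int_{\mathcal{S}}f(\zeta)\frac{1}{(2\pi i)^2}\frac{\partial\rho(\zeta)\wedge\bar\partial\partial\rho(\zeta)}{\langle\partial\rho(\zeta),\zeta-z\rangle^2}$. By a theorem of Lanzani and Stein (taken as known), taking boundary values this defines (by extension from, e.g., $C^1$ functions) a bounded projection operator $\mathbf{L}_{\mathcal{S}}$ on $L^2(\mathcal{S},|\nu_M|)$ whose range is the Hardy space $H^2(\mathcal{S})=H^2(\mathcal{S},|\nu_M|)$ of $L^2$ boundary values of holomorphic functions on $\Omega$; thus $H^2(\mathcal{S})=\mathbf{L}_{\mathcal{S}}(L^2(\mathcal{S}))=\ker(\mathbf{L}_{\mathcal{S}}-\mathbf{I})$.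 $\mathbf{P}_{\mathcal{S}}$ is the orthogonal projection of $L^2(\mathcal{S})$ onto $(\ker\mathbf{L}_{\mathcal{S}})^\perp$, and $W(\mathcal{S})=\{\tau(\nu_M)h:h\in(\ker\mathbf{L}_{\mathcal{S}})^\perp\}$. *)

theory Defs
  imports "HOL-Analysis.Analysis" "HOL-Library.Landau_Symbols"
begin

section \<open>Smooth functions and Wirtinger derivatives\<close>

text \<open>Meaningful on open sets \<open>U\<close>; there it is the usual class \<open>C\<^sup>k\<close>.\<close>

primrec Ck_on :: "nat \<Rightarrow> 'a::euclidean_space set \<Rightarrow> ('a \<Rightarrow> 'b::real_normed_vector) \<Rightarrow> bool" where
  "Ck_on 0 U f \<longleftrightarrow> continuous_on U f"
| "Ck_on (Suc k) U f \<longleftrightarrow>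
     (\<forall>x\<in>U. f differentiable (at x)) \<and> (\<forall>v. Ck_on k U (\<lambda>x. frechet_derivative f (at x) v))"

definition smooth_on :: "'a::euclidean_space set \<Rightarrow> ('a \<Rightarrow> 'b::real_normed_vector) \<Rightarrow> bool" where
  "smooth_on U f \<longleftrightarrow> (\<forall>k. Ck_on k U f)"

text \<open>\<open>axis j 1\<close> and \<open>axis j \<i>\<close> are the real coordinate directions \<open>x\<^sub>j\<close> and \<open>y\<^sub>j\<close> of
  \<open>\<zeta>\<^sub>j = x\<^sub>j + \<i> y\<^sub>j\<close>.\<close>

definition dz :: "2 \<Rightarrow> (complex^2 \<Rightarrow> complex) \<Rightarrow> complex^2 \<Rightarrow> complex" where
  "dz j F \<zeta> = (frechet_derivative F (at \<zeta>) (axis j 1)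
              - \<i> * frechet_derivative F (at \<zeta>) (axis j \<i>)) / 2"

definition dzbar :: "2 \<Rightarrow> (complex^2 \<Rightarrow> complex) \<Rightarrow> complex^2 \<Rightarrow> complex" where
  "dzbar j F \<zeta> = (frechet_derivative F (at \<zeta>) (axis j 1)
                 + \<i> * frechet_derivative F (at \<zeta>) (axis j \<i>)) / 2"

definition holomorphic2_on :: "(complex^2 \<Rightarrow> complex) \<Rightarrow> (complex^2) set \<Rightarrow> bool" where
  "holomorphic2_on F \<Omega> \<longleftrightarrow> (\<forall>z\<in>\<Omega>. F differentiable (at z) \<and> (\<forall>j. dzbar j F z = 0))"

definition d_rho :: "(complex^2 \<Rightarrow> real) \<Rightarrow> 2 \<Rightarrow> complex^2 \<Rightarrow> complex" where
  "d_rho \<rho> j = dz j (\<lambda>x. complex_of_real (\<rho> x))"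

text \<open>\<open>levi \<rho> j k\<close> is \<open>\<partial>\<^sup>2\<rho> / \<partial>\<zeta>\<^sub>j \<partial>(cnj \<zeta>\<^sub>k)\<close>.\<close>

definition levi :: "(complex^2 \<Rightarrow> real) \<Rightarrow> 2 \<Rightarrow> 2 \<Rightarrow> complex^2 \<Rightarrow> complex" where
  "levi \<rho> j k = dzbar k (d_rho \<rho> j)"


section \<open>Domains with smooth boundary and strong C-convexity\<close>

text \<open>\<open>S\<close> is a compact smooth real hypersurface bounding the domain \<open>\<Omega>\<close>, and \<open>\<rho>\<close>, defined on the
  neighbourhood \<open>U\<close> of \<open>S\<close>, is a defining function, negative inside \<open>\<Omega>\<close>.\<close>

definition smooth_boundary_of ::
    "(complex^2) set \<Rightarrow> (complex^2) set \<Rightarrow> (complex^2) set \<Rightarrow> (complex^2 \<Rightarrow> real) \<Rightarrow> bool" where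
  "smooth_boundary_of S \<Omega> U \<rho> \<longleftrightarrow>
     open \<Omega> \<and> connected \<Omega> \<and> \<Omega> \<noteq> {} \<and> bounded \<Omega> \<and> S = frontier \<Omega> \<and> compact S \<and>
     open U \<and> S \<subseteq> U \<and> smooth_on U \<rho> \<and>
     S = {\<zeta>\<in>U. \<rho> \<zeta> = 0} \<and> \<Omega> \<inter> U = {\<zeta>\<in>U. \<rho> \<zeta> < 0} \<and>
     (\<forall>\<zeta>\<in>S. frechet_derivative \<rho> (at \<zeta>) \<noteq> (\<lambda>v. 0))"

definition strongly_pseudoconvex :: "(complex^2) set \<Rightarrow> (complex^2 \<Rightarrow> real) \<Rightarrow> bool" where
  "strongly_pseudoconvex S \<rho> \<longleftrightarrow>
     (\<forall>\<zeta>\<in>S. \<forall>t. t \<noteq> 0 \<and> (\<Sum>j\<in>UNIV. d_rho \<rho> j \<zeta> * t$j) = 0 \<longrightarrow>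
        Re (\<Sum>j\<in>UNIV. \<Sum>k\<in>UNIV. levi \<rho> j k \<zeta> * t$j * cnj (t$k)) > 0)"

text \<open>\<open>(z\<^sub>1, z\<^sub>2)\<close> stands for the point \<open>[1 : z\<^sub>1 : z\<^sub>2]\<close> of the projective plane, on which an
  invertible matrix acts linearly in the homogeneous coordinates.\<close>

definition homog :: "complex^2 \<Rightarrow> complex^3" where
  "homog z = vector [1, z$1, z$2]"

definition proj_map :: "complex^3^3 \<Rightarrow> complex^2 \<Rightarrow> complex^2" where
  "proj_map A z = vector [(A *v homog z)$2 / (A *v homog z)$1, (A *v homog z)$3 / (A *v homog z)$1]"

text \<open>The condition \<open>(A *v homog p)$1 \<noteq> 0\<close> says that the image of \<open>p\<close> is a finite point. A
  hypersurface through \<open>0\<close> satisfying the asymptotic relation below is near \<open>0\<close> a graph over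
  \<open>(\<zeta>\<^sub>1, Re \<zeta>\<^sub>2)\<close>. The reflection \<open>\<zeta>\<^sub>2 \<mapsto> -\<zeta>\<^sub>2\<close> changes the sign of the quadratic form, so the
  definition asks for some normalising automorphism with a positive definite form.\<close>

definition strongly_C_convex :: "(complex^2) set \<Rightarrow> (complex^2 \<Rightarrow> real) \<Rightarrow> bool" where
  "strongly_C_convex S \<rho> \<longleftrightarrow>
     connected S \<and> strongly_pseudoconvex S \<rho> \<and>
     (\<forall>p\<in>S. \<exists>(A :: complex^3^3) (\<alpha>::real) (b::complex) (c::real).
        invertible A \<and> (A *v homog p)$1 \<noteq> 0 \<and> proj_map A p = 0 \<and>
        (\<lambda>\<zeta>. let \<eta> = proj_map A \<zeta> in
            Im (\<eta>$2) - (\<alpha> * (cmod (\<eta>$1))\<^sup>2 + Re (b * (\<eta>$1)\<^sup>2) + c * (Re (\<eta>$2))\<^sup>2))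
          \<in> O[at p within S](\<lambda>\<zeta>. let \<eta> = proj_map A \<zeta> in norm (\<eta>$1, Re (\<eta>$2)) ^ 3) \<and>
        (\<forall>t::complex. t \<noteq> 0 \<longrightarrow> \<alpha> * (cmod t)\<^sup>2 + Re (b * t\<^sup>2) > 0))"


section \<open>Integration of 3-forms over the oriented hypersurface\<close>

text \<open>\<open>d\<close>-dimensional Hausdorff measure (\<open>d > 0\<close>), normalised so that on smooth
  \<open>d\<close>-dimensional submanifolds of Euclidean space it is the Riemannian volume. Its outer measure
  is a metric outer measure, hence countably additive on the Borel sets.\<close>

definition hausdorff_outer :: "nat \<Rightarrow> 'a::metric_space set \<Rightarrow> ennreal" where
  "hausdorff_outer d E =
     (SUP \<delta>\<in>{0<..}. INF C\<in>{C :: nat \<Rightarrow> 'a set. E \<subseteq> (\<Union>i. C i) \<and>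
                                 (\<forall>i. bounded (C i) \<and> diameter (C i) \<le> (\<delta>::real))}.
        (\<Sum>i. ennreal (unit_ball_vol (real d) * (diameter (C i) / 2) ^ d)))"

definition hausdorff_measure :: "nat \<Rightarrow> 'a::metric_space measure" where
  "hausdorff_measure d = measure_of UNIV (sets borel) (hausdorff_outer d)"

definition surface_measure :: "(complex^2) set \<Rightarrow> (complex^2) measure" where
  "surface_measure S = restrict_space (hausdorff_measure 3) S"

type_synonym form1 = "complex^2 \<Rightarrow> complex"
type_synonym form2 = "complex^2 \<Rightarrow> complex^2 \<Rightarrow> complex"
type_synonym form3 = "complex^2 \<Rightarrow> complex^2 \<Rightarrow> complex^2 \<Rightarrow> complex"

definition wedge11 :: "form1 \<Rightarrow> form1 \<Rightarrow> form2" where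
  "wedge11 \<alpha> \<beta> = (\<lambda>u v. \<alpha> u * \<beta> v - \<alpha> v * \<beta> u)"

definition wedge12 :: "form1 \<Rightarrow> form2 \<Rightarrow> form3" where
  "wedge12 \<alpha> \<omega> = (\<lambda>u v w. \<alpha> u * \<omega> v w - \<alpha> v * \<omega> u w + \<alpha> w * \<omega> u v)"

text \<open>The real gradient of \<open>\<rho>\<close> is \<open>2 cnj (\<partial>\<rho>/\<partial>\<zeta>\<^sub>j)\<close> in the \<open>j\<close>-th component.\<close>

definition outer_normal :: "(complex^2 \<Rightarrow> real) \<Rightarrow> complex^2 \<Rightarrow> complex^2" where
  "outer_normal \<rho> \<zeta> = sgn (\<chi> j. cnj (d_rho \<rho> j \<zeta>))"

text \<open>With \<open>n\<close> the outer unit normal and \<open>m\<close> a unit vector Hermitian-orthogonal to \<open>n\<close>, the real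
  basis \<open>(n, i n, m, i m)\<close> of the ambient space is positively oriented, so \<open>(i n, m, i m)\<close> is a
  positively oriented orthonormal basis of the tangent space of the boundary. The value of a 3-form
  on it is its density with respect to the surface measure.\<close>

definition form_density :: "(complex^2 \<Rightarrow> real) \<Rightarrow> (complex^2 \<Rightarrow> form3) \<Rightarrow> complex^2 \<Rightarrow> complex" where
  "form_density \<rho> \<omega> \<zeta> =
     (let n = outer_normal \<rho> \<zeta>; m = vector [- cnj (n$2), cnj (n$1)] :: complex^2
      in \<omega> \<zeta> (\<i> *s n) m (\<i> *s m))"

definition form_integral :: "(complex^2) set \<Rightarrow> (complex^2 \<Rightarrow> real) \<Rightarrow> (complex^2 \<Rightarrow> form3) \<Rightarrow> complex" where
  "form_integral S \<rho> \<omega> = (\<integral>\<zeta>. form_density \<rho> \<omega> \<zeta> \<partial>surface_measure S)"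


section \<open>The form \<open>\<nu>\<close> attached to a matrix\<close>

text \<open>The \<open>3 \<times> 3\<close> matrix \<open>M\<close> has first row \<open>(c\<^sub>1, a\<^sub>1, a\<^sub>2)\<close>, first column \<open>(c\<^sub>1, b\<^sub>1, b\<^sub>2)\<close> and
  lower right block \<open>(m\<^sub>j\<^sub>k)\<close>.\<close>

definition blk :: "complex^3^3 \<Rightarrow> complex^2^2" where
  "blk M = vector [vector [M$2$2, M$2$3], vector [M$3$2, M$3$3]]"

definition Phi :: "complex^3^3 \<Rightarrow> complex^2 \<Rightarrow> complex^2 \<Rightarrow> complex" where
  "Phi M z w = (\<Sum>i\<in>UNIV. \<Sum>j\<in>UNIV. homog w $ i * M$i$j * homog z $ j)"

definition admissible :: "complex^3^3 \<Rightarrow> (complex^2) set \<Rightarrow> (complex^2 \<Rightarrow> real) \<Rightarrow> bool" where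
  "admissible M S \<rho> \<longleftrightarrow>
     (\<forall>\<zeta>\<in>S. let u = blk M *v vector [d_rho \<rho> 2 \<zeta>, - d_rho \<rho> 1 \<zeta>];
                 v = blk M *v \<zeta> + vector [M$2$1, M$3$1]
             in det (vector [vector [u$1, v$1], vector [u$2, v$2]] :: complex^2^2) \<noteq> 0)"

definition complex_tangent_line :: "(complex^2 \<Rightarrow> real) \<Rightarrow> complex^2 \<Rightarrow> (complex^2) set" where
  "complex_tangent_line \<rho> \<zeta> = {z. (\<Sum>j\<in>UNIV. d_rho \<rho> j \<zeta> * (z$j - \<zeta>$j)) = 0}"

definition w_map :: "complex^3^3 \<Rightarrow> (complex^2 \<Rightarrow> real) \<Rightarrow> complex^2 \<Rightarrow> complex^2" where
  "w_map M \<rho> \<zeta> = (THE w. complex_tangent_line \<rho> \<zeta> = {z. Phi M z w = 0})"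

text \<open>\<open>w_map\<close> is a function on \<open>S\<close>. Its derivative within \<open>S\<close> is determined on vectors tangent to
  \<open>S\<close>, and \<open>nu_form\<close> is only ever evaluated on those.\<close>

definition nu_form :: "complex^3^3 \<Rightarrow> (complex^2) set \<Rightarrow> (complex^2 \<Rightarrow> real) \<Rightarrow> complex^2 \<Rightarrow> form3" where
  "nu_form M S \<rho> \<zeta> = (\<lambda>u1 u2 u3.
     1 / (2 * of_real pi * \<i>)\<^sup>2 *
     wedge12
       (\<lambda>v. let w = w_map M \<rho> \<zeta>; dw = frechet_derivative (w_map M \<rho>) (at \<zeta> within S) v
            in (\<Sum>i\<in>UNIV. dw$i * (blk M *v vector [M$1$3, - M$1$2])$i)
               + det (blk M) * (w$2 * dw$1 - w$1 * dw$2))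
       (wedge11 (\<lambda>v. v$1) (\<lambda>v. v$2)) u1 u2 u3)"

text \<open>\<open>sgn z = z / |z|\<close>, with the convention \<open>sgn 0 = 0\<close>; zeros of the density form a null set of
  \<open>nu_measure\<close> in any case.\<close>

definition tau :: "complex^3^3 \<Rightarrow> (complex^2) set \<Rightarrow> (complex^2 \<Rightarrow> real) \<Rightarrow> complex^2 \<Rightarrow> complex" where
  "tau M S \<rho> \<zeta> = sgn (form_density \<rho> (nu_form M S \<rho>) \<zeta>)"

definition nu_measure :: "complex^3^3 \<Rightarrow> (complex^2) set \<Rightarrow> (complex^2 \<Rightarrow> real) \<Rightarrow> (complex^2) measure" where
  "nu_measure M S \<rho> =
     density (surface_measure S) (\<lambda>\<zeta>. ennreal (cmod (form_density \<rho> (nu_form M S \<rho>) \<zeta>)))"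


section \<open>The space \<open>L\<^sup>2\<close> of a measure\<close>

text \<open>Elements of \<open>L\<^sup>2\<close> are represented by functions; equality is \<open>ae_eq\<close>. Operators are maps on
  representatives that respect \<open>ae_eq\<close>, and all subspaces below are closed under it.\<close>

definition ae_eq :: "'a measure \<Rightarrow> ('a \<Rightarrow> complex) \<Rightarrow> ('a \<Rightarrow> complex) \<Rightarrow> bool" where
  "ae_eq \<mu> f g \<longleftrightarrow> (AE x in \<mu>. f x = g x)"

definition L2 :: "'a measure \<Rightarrow> ('a \<Rightarrow> complex) set" where
  "L2 \<mu> = {f \<in> borel_measurable \<mu>. integrable \<mu> (\<lambda>x. (cmod (f x))\<^sup>2)}"

definition L2_inner :: "'a measure \<Rightarrow> ('a \<Rightarrow> complex) \<Rightarrow> ('a \<Rightarrow> complex) \<Rightarrow> complex" where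
  "L2_inner \<mu> f g = (\<integral>x. f x * cnj (g x) \<partial>\<mu>)"

definition L2_norm :: "'a measure \<Rightarrow> ('a \<Rightarrow> complex) \<Rightarrow> real" where
  "L2_norm \<mu> f = sqrt (\<integral>x. (cmod (f x))\<^sup>2 \<partial>\<mu>)"

definition L2_orth :: "'a measure \<Rightarrow> ('a \<Rightarrow> complex) set \<Rightarrow> ('a \<Rightarrow> complex) set" where
  "L2_orth \<mu> V = {g \<in> L2 \<mu>. \<forall>f\<in>V. L2_inner \<mu> f g = 0}"

definition L2_proj :: "'a measure \<Rightarrow> ('a \<Rightarrow> complex) set \<Rightarrow> ('a \<Rightarrow> complex) \<Rightarrow> ('a \<Rightarrow> complex)" where
  "L2_proj \<mu> V f = (SOME g. g \<in> V \<and> (\<lambda>x. f x - g x) \<in> L2_orth \<mu> V)"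

definition L2_bounded_op ::
    "'a measure \<Rightarrow> ('a \<Rightarrow> complex) set \<Rightarrow> ('a \<Rightarrow> complex) set \<Rightarrow> (('a \<Rightarrow> complex) \<Rightarrow> ('a \<Rightarrow> complex)) \<Rightarrow> bool" where
  "L2_bounded_op \<mu> V W T \<longleftrightarrow>
     (\<forall>f\<in>V. T f \<in> W) \<and>
     (\<forall>f\<in>V. \<forall>g\<in>V. ae_eq \<mu> f g \<longrightarrow> ae_eq \<mu> (T f) (T g)) \<and>
     (\<forall>f\<in>V. \<forall>g\<in>V. ae_eq \<mu> (T (\<lambda>x. f x + g x)) (\<lambda>x. T f x + T g x)) \<and>
     (\<forall>f\<in>V. \<forall>c. ae_eq \<mu> (T (\<lambda>x. c * f x)) (\<lambda>x. c * T f x)) \<and>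
     (\<exists>K. \<forall>f\<in>V. L2_norm \<mu> (T f) \<le> K * L2_norm \<mu> f)"

definition L2_opnorm :: "'a measure \<Rightarrow> ('a \<Rightarrow> complex) set \<Rightarrow> (('a \<Rightarrow> complex) \<Rightarrow> ('a \<Rightarrow> complex)) \<Rightarrow> real" where
  "L2_opnorm \<mu> V T = (SUP f\<in>{f\<in>V. L2_norm \<mu> f \<le> 1}. L2_norm \<mu> (T f))"

definition L2_ker :: "'a measure \<Rightarrow> (('a \<Rightarrow> complex) \<Rightarrow> ('a \<Rightarrow> complex)) \<Rightarrow> ('a \<Rightarrow> complex) set" where
  "L2_ker \<mu> T = {f \<in> L2 \<mu>. ae_eq \<mu> (T f) (\<lambda>x. 0)}"

definition L2_range :: "'a measure \<Rightarrow> (('a \<Rightarrow> complex) \<Rightarrow> ('a \<Rightarrow> complex)) \<Rightarrow> ('a \<Rightarrow> complex) set" where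
  "L2_range \<mu> T = {h \<in> L2 \<mu>. \<exists>f\<in>L2 \<mu>. ae_eq \<mu> h (T f)}"

definition L2_invertible ::
    "'a measure \<Rightarrow> ('a \<Rightarrow> complex) set \<Rightarrow> ('a \<Rightarrow> complex) set \<Rightarrow> (('a \<Rightarrow> complex) \<Rightarrow> ('a \<Rightarrow> complex)) \<Rightarrow> bool" where
  "L2_invertible \<mu> V W T \<longleftrightarrow>
     L2_bounded_op \<mu> V W T \<and>
     (\<exists>G. L2_bounded_op \<mu> W V G \<and> (\<forall>f\<in>V. ae_eq \<mu> (G (T f)) f) \<and> (\<forall>h\<in>W. ae_eq \<mu> (T (G h)) h))"


section \<open>Leray transform, Hardy space and the operators \<open>R\<close> and \<open>Q\<close>\<close>

definition del_rho :: "(complex^2 \<Rightarrow> real) \<Rightarrow> complex^2 \<Rightarrow> form1" where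
  "del_rho \<rho> \<zeta> = (\<lambda>v. \<Sum>j\<in>UNIV. d_rho \<rho> j \<zeta> * v$j)"

definition delbar_del_rho :: "(complex^2 \<Rightarrow> real) \<Rightarrow> complex^2 \<Rightarrow> form2" where
  "delbar_del_rho \<rho> \<zeta> = (\<lambda>u v. \<Sum>j\<in>UNIV. \<Sum>k\<in>UNIV.
     levi \<rho> j k \<zeta> * wedge11 (\<lambda>v. cnj (v$k)) (\<lambda>v. v$j) u v)"

definition leray :: "(complex^2) set \<Rightarrow> (complex^2 \<Rightarrow> real) \<Rightarrow> (complex^2 \<Rightarrow> complex) \<Rightarrow> complex^2 \<Rightarrow> complex" where
  "leray S \<rho> f z = form_integral S \<rho> (\<lambda>\<zeta> u1 u2 u3.
     f \<zeta> * (1 / (2 * of_real pi * \<i>)\<^sup>2) *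
     wedge12 (del_rho \<rho> \<zeta>) (delbar_del_rho \<rho> \<zeta>) u1 u2 u3 / (del_rho \<rho> \<zeta> (\<zeta> - z))\<^sup>2)"

text \<open>\<open>T\<close> is the bounded operator on \<open>L\<^sup>2(S, \<mu>)\<close> that extends the map sending a \<open>C\<^sup>1\<close> function to the
  boundary values of its Leray transform.\<close>

definition leray_L2_operator ::
    "(complex^2) measure \<Rightarrow> (complex^2) set \<Rightarrow> (complex^2) set \<Rightarrow> (complex^2 \<Rightarrow> real) \<Rightarrow>
     ((complex^2 \<Rightarrow> complex) \<Rightarrow> (complex^2 \<Rightarrow> complex)) \<Rightarrow> bool" where
  "leray_L2_operator \<mu> S \<Omega> \<rho> T \<longleftrightarrow>
     L2_bounded_op \<mu> (L2 \<mu>) (L2 \<mu>) T \<and>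
     (\<forall>f V. open V \<and> S \<subseteq> V \<and> Ck_on 1 V f \<longrightarrow>
        (AE \<zeta> in \<mu>. (leray S \<rho> f \<longlongrightarrow> T f \<zeta>) (at \<zeta> within \<Omega>)))"

text \<open>Boundary values in the sense of \<open>L\<^sup>2\<close>: the functions \<open>\<zeta> \<mapsto> F (\<zeta> - \<epsilon> n(\<zeta>))\<close> on \<open>S\<close> converge to
  \<open>h\<close> in \<open>L\<^sup>2\<close> as \<open>\<epsilon>\<close> decreases to \<open>0\<close>.\<close>

definition hardy2 ::
    "(complex^2) measure \<Rightarrow> (complex^2) set \<Rightarrow> (complex^2 \<Rightarrow> real) \<Rightarrow> (complex^2 \<Rightarrow> complex) set" where
  "hardy2 \<mu> \<Omega> \<rho> = {h \<in> L2 \<mu>. \<exists>F. holomorphic2_on F \<Omega> \<and>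
     ((\<lambda>\<epsilon>. \<integral>\<^sup>+\<zeta>. ennreal ((cmod (F (\<zeta> - \<epsilon> *\<^sub>R outer_normal \<rho> \<zeta>) - h \<zeta>))\<^sup>2) \<partial>\<mu>) \<longlongrightarrow> 0) (at_right 0)}"

text \<open>In the following, \<open>\<mu>\<close> is the measure, \<open>t\<close> the unimodular function \<open>\<tau>\<close> and \<open>T\<close> the Leray
  operator.\<close>

definition W_space ::
    "'a measure \<Rightarrow> ('a \<Rightarrow> complex) \<Rightarrow> (('a \<Rightarrow> complex) \<Rightarrow> ('a \<Rightarrow> complex)) \<Rightarrow> ('a \<Rightarrow> complex) set" where
  "W_space \<mu> t T = {f \<in> L2 \<mu>. \<exists>h\<in>L2_orth \<mu> (L2_ker \<mu> T). ae_eq \<mu> f (\<lambda>x. t x * h x)}"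

definition R_op ::
    "'a measure \<Rightarrow> ('a \<Rightarrow> complex) \<Rightarrow> (('a \<Rightarrow> complex) \<Rightarrow> ('a \<Rightarrow> complex)) \<Rightarrow> ('a \<Rightarrow> complex) \<Rightarrow> ('a \<Rightarrow> complex)" where
  "R_op \<mu> t T f = (\<lambda>x. t x * L2_proj \<mu> (L2_orth \<mu> (L2_ker \<mu> T)) f x)"

definition Q_op ::
    "('a \<Rightarrow> complex) \<Rightarrow> (('a \<Rightarrow> complex) \<Rightarrow> ('a \<Rightarrow> complex)) \<Rightarrow> ('a \<Rightarrow> complex) \<Rightarrow> ('a \<Rightarrow> complex)" where
  "Q_op t T f = T (\<lambda>x. cnj (t x) * f x)"

end

theory Submission
  imports Defs
begin

text \<open>Multiplication by \<open>\<tau>\<close> maps \<open>(ker L)\<^sup>\<bottom>\<close> isometrically onto \<open>W\<close> and turns \<open>Q\<close> into the restriction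
  of \<open>L\<close>. For a bounded projection \<open>L\<close> the maps \<open>L : (ker L)\<^sup>\<bottom> \<rightarrow> range L\<close> and
  \<open>P : range L \<rightarrow> (ker L)\<^sup>\<bottom>\<close> are mutually inverse, because both differ from the identity by elements
  of \<open>ker L\<close>. The analytic input is that \<open>\<tau>\<close> is measurable and almost everywhere unimodular: the
  density of \<open>\<nu>\<close> is continuous on \<open>S\<close>, since admissibility expresses \<open>w\<close> by Cramer's rule through
  the first derivatives of \<open>\<rho>\<close>.\<close>

section \<open>The Hilbert space structure of \<open>L\<^sup>2\<close>\<close>

text \<open>Two choice operators shape the proof. \<open>L2_proj\<close> selects its value by
  \<open>SOME\<close>, so even the existence of \<open>P f\<close> has to be established; this is
  what completeness of L2 and the orthogonal decomposition are for, with all identities read up to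
  \<open>ae_eq\<close>. Since \<open>L\<close> need not be self-adjoint, the orthogonal complement
  of its kernel and its range are in general two different complements of that kernel, and
  \<open>P\<close> and \<open>L\<close> move between them along the kernel. On the geometric side
  \<open>frechet_derivative (w_map M \<rho>) (at \<zeta> within S)\<close> is again a choice,
  because a derivative within a hypersurface is free in the normal direction. Measurability of the
  density therefore rests on uniqueness in tangent directions, after which the chosen derivative can
  be replaced by the ambient derivative of Cramer's formulas, which make sense off \<open>S\<close>
  as well.\<close>

lemma L2_measurable: "f \<in> L2 \<mu> \<Longrightarrow> f \<in> borel_measurable \<mu>"
  by (simp add: L2_def)

lemma L2_integrable: "f \<in> L2 \<mu> \<Longrightarrow> integrable \<mu> (\<lambda>x. (cmod (f x))\<^sup>2)"
  by (simp add: L2_def)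

lemma borel_measurable_cnj [measurable (raw)]:
  "f \<in> borel_measurable M \<Longrightarrow> (\<lambda>x. cnj (f x)) \<in> borel_measurable M"
  by (rule borel_measurable_continuous_on[where f = cnj]) (auto intro: continuous_intros)

lemma L2_inner_integrable:
  assumes "f \<in> L2 \<mu>" "g \<in> L2 \<mu>"
  shows "integrable \<mu> (\<lambda>x. f x * cnj (g x))"
proof (rule Bochner_Integration.integrable_bound)
  show "integrable \<mu> (\<lambda>x. (cmod (f x))\<^sup>2 + (cmod (g x))\<^sup>2)"
    using assms by (simp add: L2_integrable)
  show "(\<lambda>x. f x * cnj (g x)) \<in> borel_measurable \<mu>"
    using assms[THEN L2_measurable] by measurable
  have "a * b \<le> a\<^sup>2 + b\<^sup>2" if "a \<ge> 0" "b \<ge> 0" for a b :: real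
  proof -
    have "2 * (a * b) \<le> a\<^sup>2 + b\<^sup>2" using sum_squares_bound[of a b] by (simp add: mult.assoc)
    moreover have "0 \<le> a * b" using that by simp
    ultimately show ?thesis by linarith
  qed
  then show "AE x in \<mu>. norm (f x * cnj (g x)) \<le> norm ((cmod (f x))\<^sup>2 + (cmod (g x))\<^sup>2)"
    by (simp add: norm_mult)
qed

lemma cmod_add_sq: "(cmod (a + b))\<^sup>2 = (cmod a)\<^sup>2 + (cmod b)\<^sup>2 + 2 * Re (a * cnj b)"
  by (simp add: cmod_power2 power2_sum)

lemma L2_add:
  assumes "f \<in> L2 \<mu>" "g \<in> L2 \<mu>"
  shows "(\<lambda>x. f x + g x) \<in> L2 \<mu>"
  using assms[THEN L2_measurable] L2_inner_integrable[OF assms] assms[THEN L2_integrable]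
  \<comment> \<open>Removing \<open>times_complex.sel\<close> keeps
    \<open>Re (f x * cnj (g x))\<close> intact, so that \<open>integrable_Re\<close> applies to the
    product.\<close>
  by (simp add: L2_def cmod_add_sq integrable_Re del: times_complex.sel)

lemma L2_scale:
  assumes "f \<in> L2 \<mu>"
  shows "(\<lambda>x. c * f x) \<in> L2 \<mu>"
  using assms by (auto simp: L2_def norm_mult power_mult_distrib)

lemma L2_diff:
  assumes "f \<in> L2 \<mu>" "g \<in> L2 \<mu>"
  shows "(\<lambda>x. f x - g x) \<in> L2 \<mu>"
  using L2_add[OF assms(1) L2_scale[OF assms(2), of "-1"]] by simp

lemma L2_zero: "(\<lambda>x. 0) \<in> L2 \<mu>"
  by (simp add: L2_def)

lemma L2_norm_nonneg: "0 \<le> L2_norm \<mu> f"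
  by (simp add: L2_norm_def)

lemma L2_norm_sq: "(L2_norm \<mu> f)\<^sup>2 = (\<integral>x. (cmod (f x))\<^sup>2 \<partial>\<mu>)"
  by (simp add: L2_norm_def)

lemma L2_norm_sq_add:
  assumes "f \<in> L2 \<mu>" "g \<in> L2 \<mu>"
  shows "(L2_norm \<mu> (\<lambda>x. f x + g x))\<^sup>2
    = (L2_norm \<mu> f)\<^sup>2 + (L2_norm \<mu> g)\<^sup>2 + 2 * Re (L2_inner \<mu> f g)"
  using L2_inner_integrable[OF assms] assms[THEN L2_integrable]
  by (simp add: L2_norm_sq cmod_add_sq L2_inner_def integrable_Re integral_Re
      del: times_complex.sel)

lemma L2_norm_scale: "L2_norm \<mu> (\<lambda>x. c * f x) = cmod c * L2_norm \<mu> f"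
  by (simp add: L2_norm_def norm_mult power_mult_distrib real_sqrt_mult)

lemma L2_inner_scale_right: "L2_inner \<mu> f (\<lambda>x. c * g x) = cnj c * L2_inner \<mu> f g"
proof -
  have "(\<lambda>x. f x * cnj (c * g x)) = (\<lambda>x. cnj c * (f x * cnj (g x)))" by (simp add: mult_ac)
  then show ?thesis by (simp add: L2_inner_def)
qed

lemma L2_inner_scale_left: "L2_inner \<mu> (\<lambda>x. c * f x) g = c * L2_inner \<mu> f g"
  by (simp add: L2_inner_def mult.assoc)

lemma L2_inner_cnj: "L2_inner \<mu> g f = cnj (L2_inner \<mu> f g)"
proof -
  have "(\<lambda>x. g x * cnj (f x)) = (\<lambda>x. cnj (f x * cnj (g x)))" by (simp add: mult.commute)
  then show ?thesis by (simp only: L2_inner_def Bochner_Integration.integral_cnj)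
qed

lemma L2_inner_add_right:
  assumes "f \<in> L2 \<mu>" "g \<in> L2 \<mu>" "h \<in> L2 \<mu>"
  shows "L2_inner \<mu> f (\<lambda>x. g x + h x) = L2_inner \<mu> f g + L2_inner \<mu> f h"
  using L2_inner_integrable[OF assms(1,2)] L2_inner_integrable[OF assms(1,3)]
  by (simp add: L2_inner_def distrib_left)

lemma L2_inner_self:
  assumes "f \<in> L2 \<mu>"
  shows "L2_inner \<mu> f f = of_real ((L2_norm \<mu> f)\<^sup>2)"
  using L2_integrable[OF assms]
  unfolding L2_inner_def L2_norm_sq complex_norm_square[symmetric] by (rule integral_of_real)

lemma L2_norm_cong:
  assumes "ae_eq \<mu> f g" "f \<in> borel_measurable \<mu>" "g \<in> borel_measurable \<mu>"
  shows "L2_norm \<mu> f = L2_norm \<mu> g"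
proof -
  have "(\<integral>x. (cmod (f x))\<^sup>2 \<partial>\<mu>) = (\<integral>x. (cmod (g x))\<^sup>2 \<partial>\<mu>)"
    using assms by (intro integral_cong_AE) (auto simp: ae_eq_def)
  then show ?thesis by (simp add: L2_norm_def)
qed

lemma L2_norm_eq_0:
  assumes "f \<in> L2 \<mu>"
  shows "L2_norm \<mu> f = 0 \<longleftrightarrow> ae_eq \<mu> f (\<lambda>x. 0)"
  using integral_nonneg_eq_0_iff_AE[OF L2_integrable[OF assms]]
  by (simp add: L2_norm_def ae_eq_def)

lemma ae_eq_refl: "ae_eq \<mu> f f"
  by (simp add: ae_eq_def)

lemma ae_eq_sym: "ae_eq \<mu> f g \<Longrightarrow> ae_eq \<mu> g f"
  unfolding ae_eq_def by (auto elim: AE_mp)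

lemma ae_eq_trans: "ae_eq \<mu> f g \<Longrightarrow> ae_eq \<mu> g h \<Longrightarrow> ae_eq \<mu> f h"
  unfolding ae_eq_def by (auto elim: AE_mp)

lemma ae_eq_add:
  "ae_eq \<mu> f f' \<Longrightarrow> ae_eq \<mu> g g' \<Longrightarrow> ae_eq \<mu> (\<lambda>x. f x + g x) (\<lambda>x. f' x + g' x)"
  unfolding ae_eq_def by (auto elim: AE_mp)

lemma ae_eq_diff:
  "ae_eq \<mu> f f' \<Longrightarrow> ae_eq \<mu> g g' \<Longrightarrow> ae_eq \<mu> (\<lambda>x. f x - g x) (\<lambda>x. f' x - g' x)"
  unfolding ae_eq_def by (auto elim: AE_mp)

lemma ae_eq_mult:
  "ae_eq \<mu> f f' \<Longrightarrow> ae_eq \<mu> (\<lambda>x. g x * f x) (\<lambda>x. g x * f' x)"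
  unfolding ae_eq_def by (auto elim: AE_mp)

lemma L2_norm_triangle:
  assumes "f \<in> L2 \<mu>" "g \<in> L2 \<mu>"
  shows "L2_norm \<mu> (\<lambda>x. f x + g x) \<le> L2_norm \<mu> f + L2_norm \<mu> g"
proof -
  let ?a = "L2_norm \<mu> f" and ?b = "L2_norm \<mu> g"
  consider "?a = 0" | "?b = 0" | "?a > 0" "?b > 0"
    using L2_norm_nonneg[of \<mu> f] L2_norm_nonneg[of \<mu> g] by linarith
  then show ?thesis
  proof cases
    case 1
    then have "ae_eq \<mu> (\<lambda>x. f x + g x) (\<lambda>x. 0 + g x)"
      using assms(1) by (intro ae_eq_add ae_eq_refl) (simp add: L2_norm_eq_0)
    then have "L2_norm \<mu> (\<lambda>x. f x + g x) = L2_norm \<mu> (\<lambda>x. 0 + g x)"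
      by (rule L2_norm_cong) (use assms in \<open>auto intro!: L2_measurable L2_add\<close>)
    then show ?thesis using 1 by simp
  next
    case 2
    then have "ae_eq \<mu> (\<lambda>x. f x + g x) (\<lambda>x. f x + 0)"
      using assms(2) by (intro ae_eq_add ae_eq_refl) (simp add: L2_norm_eq_0)
    then have "L2_norm \<mu> (\<lambda>x. f x + g x) = L2_norm \<mu> (\<lambda>x. f x + 0)"
      by (rule L2_norm_cong) (use assms in \<open>auto intro!: L2_measurable L2_add\<close>)
    then show ?thesis using 2 by simp
  next
    case 3
    have "0 \<le> (L2_norm \<mu> (\<lambda>x. of_real ?b * f x + of_real (- ?a) * g x))\<^sup>2" by simp
    also have "\<dots> = 2 * (?a * ?b)\<^sup>2 - 2 * (?a * ?b) * Re (L2_inner \<mu> f g)"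
      using 3 by (subst L2_norm_sq_add[OF L2_scale[OF assms(1)] L2_scale[OF assms(2)]],
                  simp only: L2_norm_scale L2_inner_scale_right L2_inner_scale_left)
                 (simp add: power2_eq_square algebra_simps)
    finally have "(?a * ?b) * Re (L2_inner \<mu> f g) \<le> (?a * ?b) * (?a * ?b)"
      by (simp add: power2_eq_square)
    then have "Re (L2_inner \<mu> f g) \<le> ?a * ?b"
      using 3 by (auto dest: mult_left_le_imp_le)
    then have "(L2_norm \<mu> (\<lambda>x. f x + g x))\<^sup>2 \<le> (?a + ?b)\<^sup>2"
      by (simp add: L2_norm_sq_add[OF assms] power2_sum)
    then show ?thesis
      by (rule power2_le_imp_le) (simp add: L2_norm_nonneg)
  qed
qed

text \<open>The weights \<open>2 ^ n\<close> make the squared increments summable almost everywhere with geometric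
  decay, so pointwise convergence follows without Minkowski's inequality.\<close>

lemma L2_complete:
  assumes f: "\<And>n. f n \<in> L2 \<mu>"
    and fast: "\<And>n m. n \<le> m \<Longrightarrow> (L2_norm \<mu> (\<lambda>x. f m x - f n x))\<^sup>2 \<le> (1/4) ^ n"
  obtains g where "g \<in> L2 \<mu>" "\<And>n. (L2_norm \<mu> (\<lambda>x. g x - f n x))\<^sup>2 \<le> (1/4) ^ n"
proof -
  have [measurable]: "f n \<in> borel_measurable \<mu>" for n
    by (rule L2_measurable[OF f])
  have nn: "(\<integral>\<^sup>+x. ennreal ((cmod (f m x - f n x))\<^sup>2) \<partial>\<mu>) \<le> ennreal ((1/4) ^ n)" if "n \<le> m" for n m
    using fast[OF that] nn_integral_eq_integral[OF L2_integrable[OF L2_diff[OF f f]], of m n]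
    by (simp add: L2_norm_sq ennreal_leI)
  define d where "d n x = 2 ^ n * (cmod (f (Suc n) x - f n x))\<^sup>2" for n x
  have [measurable]: "d n \<in> borel_measurable \<mu>" for n
    unfolding d_def[abs_def] by measurable
  have d0: "0 \<le> d n x" for n x by (simp add: d_def)
  have "(\<integral>\<^sup>+x. (\<Sum>n. ennreal (d n x)) \<partial>\<mu>) = (\<Sum>n. \<integral>\<^sup>+x. ennreal (d n x) \<partial>\<mu>)"
    by (rule nn_integral_suminf) measurable
  also have "\<dots> \<le> (\<Sum>n. ennreal ((1/2) ^ n))"
  proof (intro suminf_le summableI)
    fix n
    have "(\<integral>\<^sup>+x. ennreal (d n x) \<partial>\<mu>)
        = ennreal (2 ^ n) * (\<integral>\<^sup>+x. ennreal ((cmod (f (Suc n) x - f n x))\<^sup>2) \<partial>\<mu>)"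
      by (subst nn_integral_cmult[symmetric]) (simp_all add: d_def ennreal_mult)
    also have "\<dots> \<le> ennreal (2 ^ n) * ennreal ((1/4) ^ n)"
      by (intro mult_left_mono nn) auto
    also have "\<dots> = ennreal ((1/2) ^ n)"
      by (simp add: ennreal_mult[symmetric] power_mult_distrib[symmetric])
    finally show "(\<integral>\<^sup>+x. ennreal (d n x) \<partial>\<mu>) \<le> ennreal ((1/2) ^ n)" .
  qed
  also have "\<dots> = ennreal (\<Sum>n. (1/2) ^ n)"
    by (intro suminf_ennreal2 summable_geometric) auto
  finally have "(\<integral>\<^sup>+x. (\<Sum>n. ennreal (d n x)) \<partial>\<mu>) \<noteq> \<infinity>"
    by (auto simp: top_unique)
  then have "AE x in \<mu>. (\<Sum>n. ennreal (d n x)) \<noteq> \<infinity>"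
    by (intro nn_integral_noteq_infinite) measurable
  then have lim: "AE x in \<mu>. (\<lambda>n. f n x) \<longlonglongrightarrow> lim (\<lambda>n. f n x)"
  proof eventually_elim
    case (elim x)
    then have "summable (\<lambda>n. d n x)"
      using d0 by (intro summable_suminf_not_top) (auto simp: top_unique)
    then have "Bseq (\<lambda>n. d n x)"
      by (intro convergent_imp_Bseq convergentI[OF summable_LIMSEQ_zero])
    then obtain B where B: "B > 0" "\<And>n. norm (d n x) \<le> B"
      by (auto elim: BseqE)
    have step: "cmod (f (Suc n) x - f n x) \<le> sqrt B * (sqrt (1/2)) ^ n" for n
    proof (rule power2_le_imp_le)
      have "2 ^ n * (cmod (f (Suc n) x - f n x))\<^sup>2 \<le> B"
        using B(2)[of n] by (simp add: d_def)
      then have "(cmod (f (Suc n) x - f n x))\<^sup>2 \<le> B * (1/2) ^ n"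
        by (simp add: field_simps power_one_over)
      also have "\<dots> = (sqrt B * (sqrt (1/2)) ^ n)\<^sup>2"
        using B(1) by (simp add: power_mult_distrib power_even_eq[symmetric] flip: power_mult)
           (simp add: power_mult mult.commute[of n 2])
      finally show "(cmod (f (Suc n) x - f n x))\<^sup>2 \<le> (sqrt B * (sqrt (1/2)) ^ n)\<^sup>2" .
    qed (use B in auto)
    have "summable (\<lambda>n. sqrt B * (sqrt (1/2)) ^ n)"
      by (intro summable_mult summable_geometric) (simp add: real_sqrt_divide)
    then have "summable (\<lambda>n. f (Suc n) x - f n x)"
      by (rule summable_comparison_test'[where N = 0]) (use step in auto)
    then have "(\<lambda>n. (\<Sum>i<n. f (Suc i) x - f i x) + f 0 x)
        \<longlonglongrightarrow> (\<Sum>i. f (Suc i) x - f i x) + f 0 x"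
      by (intro tendsto_intros summable_LIMSEQ)
    then have "(\<lambda>n. f n x) \<longlonglongrightarrow> (\<Sum>i. f (Suc i) x - f i x) + f 0 x"
      using sum_lessThan_telescope[of "\<lambda>i. f i x"] by simp
    then show ?case
      by (intro convergentI[THEN convergent_LIMSEQ_iff[THEN iffD1]])
  qed
  \<comment> \<open>\<open>lim\<close> is total: at the null set of divergent points
    \<open>g\<close> takes an unspecified value, yet it stays measurable.\<close>
  define g where "g x = lim (\<lambda>n. f n x)" for x
  have [measurable]: "g \<in> borel_measurable \<mu>"
    unfolding g_def[abs_def] by (rule borel_measurable_lim_metric) measurable
  \<comment> \<open>Fatou's lemma carries the bound for \<open>f m - f n\<close> over to the limit
    in \<open>m\<close>.\<close>
  have gn: "(\<integral>\<^sup>+x. ennreal ((cmod (g x - f n x))\<^sup>2) \<partial>\<mu>) \<le> ennreal ((1/4) ^ n)" for n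
  proof -
    have "AE x in \<mu>. ennreal ((cmod (g x - f n x))\<^sup>2)
        = liminf (\<lambda>m. ennreal ((cmod (f m x - f n x))\<^sup>2))"
      using lim
    proof eventually_elim
      case (elim x)
      then have "(\<lambda>m. ennreal ((cmod (f m x - f n x))\<^sup>2)) \<longlonglongrightarrow> ennreal ((cmod (g x - f n x))\<^sup>2)"
        by (intro tendsto_intros) (simp add: g_def)
      then show ?case by (rule lim_imp_Liminf[OF sequentially_bot, symmetric])
    qed
    then have "(\<integral>\<^sup>+x. ennreal ((cmod (g x - f n x))\<^sup>2) \<partial>\<mu>)
        = (\<integral>\<^sup>+x. liminf (\<lambda>m. ennreal ((cmod (f m x - f n x))\<^sup>2)) \<partial>\<mu>)"
      by (rule nn_integral_cong_AE)
    also have "\<dots> \<le> liminf (\<lambda>m. \<integral>\<^sup>+x. ennreal ((cmod (f m x - f n x))\<^sup>2) \<partial>\<mu>)"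
      by (rule nn_integral_liminf) measurable
    also have "\<dots> \<le> liminf (\<lambda>m. ennreal ((1/4) ^ n))"
      by (intro Liminf_mono eventually_sequentiallyI[of n] nn)
    also have "\<dots> = ennreal ((1/4) ^ n)"
      by (simp add: Liminf_const)
    finally show ?thesis .
  qed
  have diff: "(\<lambda>x. g x - f n x) \<in> L2 \<mu>" for n
    unfolding L2_def
    using gn[of n] by (auto intro!: integrableI_bounded simp: less_top[symmetric] top_unique)
  show thesis
  proof (rule that)
    show "g \<in> L2 \<mu>"
      using L2_add[OF diff[of 0] f[of 0]] by simp
    show "(L2_norm \<mu> (\<lambda>x. g x - f n x))\<^sup>2 \<le> (1/4) ^ n" for n
      using gn[of n] nn_integral_eq_integral[OF L2_integrable[OF diff[of n]]]
      by (simp add: L2_norm_sq)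
  qed
qed

text \<open>\<open>k\<close> is the point of \<open>K\<close> nearest to \<open>f\<close>: the
  parallelogram law makes a minimising sequence Cauchy, and minimality along \<open>k - c v\<close>
  forces \<open>f - k\<close> to be orthogonal to every \<open>v\<close> in
  \<open>K\<close>.\<close>

lemma L2_orthogonal_decomposition:
  assumes K: "K \<subseteq> L2 \<mu>" and K0: "(\<lambda>x. 0) \<in> K"
    and Kadd: "\<And>u v. u \<in> K \<Longrightarrow> v \<in> K \<Longrightarrow> (\<lambda>x. u x + v x) \<in> K"
    and Kscale: "\<And>c u. u \<in> K \<Longrightarrow> (\<lambda>x. c * u x) \<in> K"
    and Kclosed: "\<And>u g. (\<And>n. u n \<in> K) \<Longrightarrow> g \<in> L2 \<mu> \<Longrightarrow>
        (\<lambda>n. L2_norm \<mu> (\<lambda>x. g x - u n x)) \<longlonglongrightarrow> 0 \<Longrightarrow> g \<in> K"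
    and f: "f \<in> L2 \<mu>"
  obtains k where "k \<in> K" "(\<lambda>x. f x - k x) \<in> L2_orth \<mu> K"
proof -
  define D where "D k = (L2_norm \<mu> (\<lambda>x. f x - k x))\<^sup>2" for k
  define m where "m = Inf (D ` K)"
  have bdd: "bdd_below (D ` K)"
    by (rule bdd_belowI[of _ 0]) (auto simp: D_def)
  have m_le: "m \<le> D k" if "k \<in> K" for k
    unfolding m_def using bdd that by (intro cInf_lower) auto
  have fk: "(\<lambda>x. f x - k x) \<in> L2 \<mu>" if "k \<in> K" for k
    using that K f by (intro L2_diff) auto
  \<comment> \<open>The tolerance fits the rate demanded by \<open>L2_complete\<close>: by
    \<open>par\<close> the squared distance of \<open>u i\<close> and \<open>u j\<close> is at most
    \<open>2 * (1/4)^i / 4 + 2 * (1/4)^j / 4\<close>, hence at most \<open>(1/4)^i\<close> for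
    \<open>i \<le> j\<close>.\<close>
  have "\<exists>k\<in>K. D k < m + (1/4) ^ n / 4" for n
    using cInf_lessD[of "D ` K" "m + (1/4) ^ n / 4"] K0 by (auto simp: m_def)
  then obtain u where u: "\<And>n. u n \<in> K" "\<And>n. D (u n) < m + (1/4) ^ n / 4"
    by metis
  have par: "(L2_norm \<mu> (\<lambda>x. k x - l x))\<^sup>2 \<le> 2 * (D k - m) + 2 * (D l - m)"
    if k: "k \<in> K" and l: "l \<in> K" for k l
  proof -
    \<comment> \<open>The midpoint \<open>?h\<close> lies in \<open>K\<close>, so
      \<open>?q + ?p = 2 (f - ?h)\<close> has squared norm at least \<open>4 * m\<close>; adding
      \<open>1\<close> and \<open>2\<close> cancels the inner product.\<close>
    let ?p = "\<lambda>x. f x - k x" and ?q = "\<lambda>x. f x - l x" and ?h = "\<lambda>x. (1/2) * (k x + l x)"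
    have 1: "(L2_norm \<mu> (\<lambda>x. ?q x + (-1) * ?p x))\<^sup>2 = D l + D k - 2 * Re (L2_inner \<mu> ?q ?p)"
      using L2_norm_sq_add[OF fk[OF l] L2_scale[OF fk[OF k]], of "-1"]
      by (simp only: L2_norm_scale L2_inner_scale_right) (simp add: D_def)
    have 2: "(L2_norm \<mu> (\<lambda>x. ?q x + ?p x))\<^sup>2 = D l + D k + 2 * Re (L2_inner \<mu> ?q ?p)"
      using L2_norm_sq_add[OF fk[OF l] fk[OF k]] by (simp add: D_def)
    have e1: "(\<lambda>x. ?q x + (-1) * ?p x) = (\<lambda>x. k x - l x)" by auto
    have e2: "(\<lambda>x. ?q x + ?p x) = (\<lambda>x. 2 * (f x - ?h x))" by (auto simp: field_simps)
    have "?h \<in> K" using k l by (intro Kscale Kadd)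
    then have "4 * m \<le> (L2_norm \<mu> (\<lambda>x. 2 * (f x - ?h x)))\<^sup>2"
      using m_le[of ?h] by (simp only: L2_norm_scale) (simp add: D_def power_mult_distrib)
    moreover have "A \<le> 2 * (D k - m) + 2 * (D l - m)"
      if "4 * m \<le> X" "A = D l + D k - 2 * I" "X = D l + D k + 2 * I" for A X I
      using that by (simp add: algebra_simps)
    ultimately show ?thesis
      using 1 2 unfolding e1 e2 by blast
  qed
  have fast: "(L2_norm \<mu> (\<lambda>x. u j x - u i x))\<^sup>2 \<le> (1/4) ^ i" if "i \<le> j" for i j
  proof -
    define a where "a = (1/4 :: real) ^ i"
    define b where "b = (1/4 :: real) ^ j"
    have "b \<le> a"
      unfolding a_def b_def using that by (intro power_decreasing) auto
    moreover have "X \<le> a"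
      if "b \<le> a" "X \<le> 2 * (s - m) + 2 * (t - m)" "t < m + a / 4" "s < m + b / 4" for X s t
      using that by argo
    ultimately show ?thesis
      using par[OF u(1) u(1), of j i] u(2)[of i, folded a_def] u(2)[of j, folded b_def]
      by (fold a_def)
  qed
  have uL: "u n \<in> L2 \<mu>" for n using u(1) K by auto
  obtain k where k: "k \<in> L2 \<mu>" "\<And>n. (L2_norm \<mu> (\<lambda>x. k x - u n x))\<^sup>2 \<le> (1/4) ^ n"
    using L2_complete[OF uL fast] by blast
  have "(\<lambda>n. (L2_norm \<mu> (\<lambda>x. k x - u n x))\<^sup>2) \<longlonglongrightarrow> 0"
    by (rule tendsto_sandwich[OF _ _ tendsto_const LIMSEQ_power_zero[of "1/4::real"]])
       (use k(2) in auto)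
  then have tend: "(\<lambda>n. L2_norm \<mu> (\<lambda>x. k x - u n x)) \<longlonglongrightarrow> 0"
    using tendsto_real_sqrt by (fastforce simp: L2_norm_nonneg)
  have kK: "k \<in> K"
    by (rule Kclosed[OF u(1) k(1) tend])
  have Dk: "D k = m"
  proof (rule antisym)
    let ?e = "\<lambda>n. L2_norm \<mu> (\<lambda>x. k x - u n x)"
    have "L2_norm \<mu> (\<lambda>x. f x - k x) \<le> sqrt (m + (1/4) ^ n / 4) + ?e n" for n
    proof -
      have eq: "(\<lambda>x. f x - k x) = (\<lambda>x. (f x - u n x) + (- 1) * (k x - u n x))" by auto
      have "L2_norm \<mu> (\<lambda>x. f x - k x) \<le> L2_norm \<mu> (\<lambda>x. f x - u n x) + ?e n"
        unfolding eq using L2_norm_triangle[OF fk[OF u(1)] L2_scale[OF L2_diff[OF k(1) uL]], of n "-1" n]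
        by (simp only: L2_norm_scale) simp
      moreover have "L2_norm \<mu> (\<lambda>x. f x - u n x) \<le> sqrt (m + (1/4) ^ n / 4)"
        using u(2)[of n] by (intro real_le_rsqrt) (simp add: D_def)
      ultimately show ?thesis by linarith
    qed
    moreover have "(\<lambda>n. sqrt (m + (1/4) ^ n / 4) + ?e n) \<longlonglongrightarrow> sqrt (m + 0 / 4) + 0"
      by (intro tendsto_intros tend LIMSEQ_power_zero) auto
    ultimately have "L2_norm \<mu> (\<lambda>x. f x - k x) \<le> sqrt m"
      by (intro LIMSEQ_le_const[where X = "\<lambda>n. sqrt (m + (1/4) ^ n / 4) + ?e n"]) auto
    then have "(L2_norm \<mu> (\<lambda>x. f x - k x))\<^sup>2 \<le> (sqrt m)\<^sup>2"
      using L2_norm_nonneg by (rule power_mono)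
    moreover have "m \<ge> 0"
      unfolding m_def using K0 by (intro cInf_greatest) (auto simp: D_def)
    ultimately show "D k \<le> m" by (simp add: D_def)
  qed (rule m_le[OF kK])
  show thesis
  proof (rule that[OF kK])
    let ?r = "\<lambda>x. f x - k x"
    have "L2_inner \<mu> v ?r = 0" if v: "v \<in> K" for v
    proof -
      define I where "I = L2_inner \<mu> ?r v"
      define N where "N = (L2_norm \<mu> v)\<^sup>2"
      \<comment> \<open>The \<open>1\<close> in the denominator covers a null \<open>v\<close> and
        gives \<open>s * N < 1\<close>. Replacing \<open>k\<close> by \<open>k - c v\<close> with
        \<open>c = - s I\<close> changes \<open>D\<close> by \<open>s (s N - 2) |I|^2\<close>, which
        is negative unless \<open>I = 0\<close>.\<close>
      define s where "s = 1 / (N + 1)"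
      define c where "c = - of_real s * I"
      have N: "N \<ge> 0" by (simp add: N_def)
      have s: "s > 0" "s * N < 1" using N by (auto simp: s_def field_simps)
      have vL: "v \<in> L2 \<mu>" using v K by auto
      have "(\<lambda>x. k x + (- c) * v x) \<in> K"
        using v kK by (intro Kadd Kscale)
      from m_le[OF this] have "D k \<le> D (\<lambda>x. k x + (- c) * v x)"
        by (simp only: Dk)
      also have "\<dots> = (L2_norm \<mu> (\<lambda>x. ?r x + c * v x))\<^sup>2"
        by (simp add: D_def algebra_simps)
      also have "\<dots> = D k + (cmod c)\<^sup>2 * N + 2 * Re (cnj c * I)"
        using L2_norm_sq_add[OF fk[OF kK] L2_scale[OF vL], of c]
        by (simp only: L2_norm_scale L2_inner_scale_right)
           (simp add: D_def N_def I_def power_mult_distrib)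
      finally have "0 \<le> (cmod c)\<^sup>2 * N + 2 * Re (cnj c * I)" by simp
      moreover have "(cmod c)\<^sup>2 = s\<^sup>2 * (cmod I)\<^sup>2"
        using s(1) by (simp add: c_def norm_mult power_mult_distrib)
      moreover have "Re (cnj c * I) = - s * (cmod I)\<^sup>2"
        by (simp add: c_def cmod_power2) (simp add: power2_eq_square algebra_simps)
      ultimately have "0 \<le> s * (s * N - 2) * (cmod I)\<^sup>2"
        by (simp add: power2_eq_square algebra_simps)
      moreover have "s * (s * N - 2) < 0"
        using s by (intro mult_pos_neg) auto
      ultimately have "(cmod I)\<^sup>2 \<le> 0"
        by (metis mult_neg_pos not_le)
      then have "I = 0" by simp
      then show ?thesis
        using L2_inner_cnj[of \<mu> v ?r] by (simp add: I_def)
    qed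
    then show "?r \<in> L2_orth \<mu> K"
      using fk[OF kK] by (simp add: L2_orth_def)
  qed
qed

section \<open>Unimodular multipliers, bounded operators and operator norms\<close>

lemma L2_mult_unimodular:
  assumes s: "s \<in> borel_measurable \<mu>" "AE x in \<mu>. cmod (s x) = 1" and f: "f \<in> L2 \<mu>"
  shows "(\<lambda>x. s x * f x) \<in> L2 \<mu>" "L2_norm \<mu> (\<lambda>x. s x * f x) = L2_norm \<mu> f"
proof -
  note [measurable] = s(1) L2_measurable[OF f]
  have eq: "AE x in \<mu>. (cmod (s x * f x))\<^sup>2 = (cmod (f x))\<^sup>2"
    using s(2) by eventually_elim (simp add: norm_mult)
  show "(\<lambda>x. s x * f x) \<in> L2 \<mu>"
    using L2_integrable[OF f] eq unfolding L2_def
    by (auto intro: integrable_cong_AE_imp)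
  have "(\<integral>x. (cmod (s x * f x))\<^sup>2 \<partial>\<mu>) = (\<integral>x. (cmod (f x))\<^sup>2 \<partial>\<mu>)"
    by (rule integral_cong_AE) (use eq in auto)
  then show "L2_norm \<mu> (\<lambda>x. s x * f x) = L2_norm \<mu> f"
    by (simp add: L2_norm_def)
qed

lemma L2_bounded_op_nonneg_bound:
  assumes "L2_bounded_op \<mu> V W T"
  obtains K where "K \<ge> 0" "\<And>f. f \<in> V \<Longrightarrow> L2_norm \<mu> (T f) \<le> K * L2_norm \<mu> f"
proof -
  obtain K where K: "\<And>f. f \<in> V \<Longrightarrow> L2_norm \<mu> (T f) \<le> K * L2_norm \<mu> f"
    using assms unfolding L2_bounded_op_def by blast
  show thesis
  \<comment> \<open>The constant from the definition may be negative when all functions in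
    \<open>V\<close> are null; truncation at \<open>0\<close> allows inequalities to be multiplied
    by it.\<close>
  proof (rule that[of "max K 0"])
    fix f assume "f \<in> V"
    then have "L2_norm \<mu> (T f) \<le> K * L2_norm \<mu> f" by (rule K)
    also have "\<dots> \<le> max K 0 * L2_norm \<mu> f"
      by (intro mult_right_mono L2_norm_nonneg) simp
    finally show "L2_norm \<mu> (T f) \<le> max K 0 * L2_norm \<mu> f" .
  qed simp
qed

lemma L2_bounded_op_restrict:
  assumes "L2_bounded_op \<mu> V W T" "V' \<subseteq> V" "\<And>f. f \<in> V' \<Longrightarrow> T f \<in> W'"
  shows "L2_bounded_op \<mu> V' W' T"
proof -
  have "\<exists>K. \<forall>f\<in>V'. L2_norm \<mu> (T f) \<le> K * L2_norm \<mu> f"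
    using assms(1,2) unfolding L2_bounded_op_def by (meson subsetD)
  then show ?thesis
    using assms unfolding L2_bounded_op_def by (simp add: subset_eq)
qed

text \<open>A real \<open>SUP\<close> controls its members only for a set bounded above; the
  operator bound on the unit ball provides this.\<close>

lemma L2_opnorm_upper:
  assumes "L2_bounded_op \<mu> V W T" "f \<in> V" "L2_norm \<mu> f \<le> 1"
  shows "L2_norm \<mu> (T f) \<le> L2_opnorm \<mu> V T"
proof -
  obtain K where K: "K \<ge> 0" "\<And>f. f \<in> V \<Longrightarrow> L2_norm \<mu> (T f) \<le> K * L2_norm \<mu> f"
    using L2_bounded_op_nonneg_bound[OF assms(1)] by blast
  have "L2_norm \<mu> (T g) \<le> K" if "g \<in> V" "L2_norm \<mu> g \<le> 1" for g
    using K(2)[OF that(1)] mult_left_mono[OF that(2) K(1)] by simp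
  then have "bdd_above ((\<lambda>f. L2_norm \<mu> (T f)) ` {f\<in>V. L2_norm \<mu> f \<le> 1})"
    by (intro bdd_aboveI2[of _ _ K]) auto
  then show ?thesis
    unfolding L2_opnorm_def using assms(2,3) by (intro cSUP_upper) auto
qed

text \<open>\<open>f0\<close> witnesses that the unit ball is nonempty, without which the real
  supremum says nothing.\<close>

lemma L2_opnorm_least:
  assumes "f0 \<in> V" "L2_norm \<mu> f0 \<le> 1"
    "\<And>f. f \<in> V \<Longrightarrow> L2_norm \<mu> f \<le> 1 \<Longrightarrow> L2_norm \<mu> (T f) \<le> b"
  shows "L2_opnorm \<mu> V T \<le> b"
  unfolding L2_opnorm_def using assms by (intro cSUP_least) auto

section \<open>Bounded projections and the operators \<open>R\<close> and \<open>Q\<close>\<close>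

locale L2_projection =
  fixes \<mu> :: "'a measure" and T :: "('a \<Rightarrow> complex) \<Rightarrow> ('a \<Rightarrow> complex)" and t :: "'a \<Rightarrow> complex"
  assumes T_bounded: "L2_bounded_op \<mu> (L2 \<mu>) (L2 \<mu>) T"
    and T_idem: "\<And>f. f \<in> L2 \<mu> \<Longrightarrow> ae_eq \<mu> (T (T f)) (T f)"
    and t_measurable: "t \<in> borel_measurable \<mu>"
    and t_unimodular: "AE x in \<mu>. cmod (t x) = 1"
begin

abbreviation "K \<equiv> L2_ker \<mu> T"
abbreviation "N \<equiv> L2_orth \<mu> K"
abbreviation "P \<equiv> L2_proj \<mu> N"

lemma T_L2: "f \<in> L2 \<mu> \<Longrightarrow> T f \<in> L2 \<mu>"
  and T_cong: "f \<in> L2 \<mu> \<Longrightarrow> g \<in> L2 \<mu> \<Longrightarrow> ae_eq \<mu> f g \<Longrightarrow> ae_eq \<mu> (T f) (T g)"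
  and T_add: "f \<in> L2 \<mu> \<Longrightarrow> g \<in> L2 \<mu> \<Longrightarrow> ae_eq \<mu> (T (\<lambda>x. f x + g x)) (\<lambda>x. T f x + T g x)"
  and T_scale: "f \<in> L2 \<mu> \<Longrightarrow> ae_eq \<mu> (T (\<lambda>x. c * f x)) (\<lambda>x. c * T f x)"
  using T_bounded unfolding L2_bounded_op_def by blast+

lemma T_diff:
  assumes "f \<in> L2 \<mu>" "g \<in> L2 \<mu>"
  shows "ae_eq \<mu> (T (\<lambda>x. f x - g x)) (\<lambda>x. T f x - T g x)"
proof -
  have "ae_eq \<mu> (T (\<lambda>x. f x + (-1) * g x)) (\<lambda>x. T f x + (-1) * T g x)"
    by (rule ae_eq_trans[OF T_add[OF assms(1) L2_scale[OF assms(2)]]])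
       (intro ae_eq_add ae_eq_refl T_scale assms)
  then show ?thesis by simp
qed

section \<open>The kernel as a closed subspace\<close>

lemma ker_L2: "k \<in> K \<Longrightarrow> k \<in> L2 \<mu>"
  and ker_ae: "k \<in> K \<Longrightarrow> ae_eq \<mu> (T k) (\<lambda>x. 0)"
  by (simp_all add: L2_ker_def)

lemma ker_add:
  assumes "u \<in> K" "v \<in> K"
  shows "(\<lambda>x. u x + v x) \<in> K"
proof -
  have "ae_eq \<mu> (T (\<lambda>x. u x + v x)) (\<lambda>x. 0 + 0)"
    by (rule ae_eq_trans[OF T_add[OF assms[THEN ker_L2]]]) (intro ae_eq_add ker_ae assms)
  then show ?thesis using assms by (simp add: L2_ker_def L2_add)
qed

lemma ker_scale:
  assumes "u \<in> K"
  shows "(\<lambda>x. c * u x) \<in> K"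
proof -
  have "ae_eq \<mu> (T (\<lambda>x. c * u x)) (\<lambda>x. c * 0)"
    by (rule ae_eq_trans[OF T_scale[OF ker_L2[OF assms]]]) (intro ae_eq_mult ker_ae assms)
  then show ?thesis using assms by (simp add: L2_ker_def L2_scale)
qed

lemma ker_diff: "u \<in> K \<Longrightarrow> v \<in> K \<Longrightarrow> (\<lambda>x. u x - v x) \<in> K"
  using ker_add[OF _ ker_scale[of v "-1"], of u] by simp

lemma ker_ae_0:
  assumes "f \<in> L2 \<mu>" "ae_eq \<mu> f (\<lambda>x. 0)"
  shows "f \<in> K"
proof -
  \<comment> \<open>The zero function is written as \<open>0 * f\<close>, so that homogeneity of
    \<open>T\<close> shows its image to be null.\<close>
  have "ae_eq \<mu> (T f) (T (\<lambda>x. 0 * f x))"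
    using assms by (intro T_cong L2_scale) auto
  from ae_eq_trans[OF this T_scale[OF assms(1)]] show ?thesis
    using assms(1) by (simp add: L2_ker_def)
qed

text \<open>\<open>T\<close> takes the same value on \<open>g - u n\<close> as on \<open>g\<close>
  almost everywhere, so boundedness squeezes the norm of \<open>T g\<close> to
  \<open>0\<close>.\<close>

lemma ker_closed:
  assumes u: "\<And>n. u n \<in> K" and g: "g \<in> L2 \<mu>"
    and lim: "(\<lambda>n. L2_norm \<mu> (\<lambda>x. g x - u n x)) \<longlonglongrightarrow> 0"
  shows "g \<in> K"
proof -
  obtain C where C: "\<And>f. f \<in> L2 \<mu> \<Longrightarrow> L2_norm \<mu> (T f) \<le> C * L2_norm \<mu> f"
    using T_bounded unfolding L2_bounded_op_def by blast
  have "L2_norm \<mu> (T g) \<le> C * L2_norm \<mu> (\<lambda>x. g x - u n x)" for n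
  proof -
    have d: "(\<lambda>x. g x - u n x) \<in> L2 \<mu>" using g u by (simp add: L2_diff ker_L2)
    have "ae_eq \<mu> (T (\<lambda>x. g x - u n x)) (\<lambda>x. T g x - 0)"
      by (rule ae_eq_trans[OF T_diff[OF g ker_L2[OF u]]]) (intro ae_eq_diff ae_eq_refl ker_ae u)
    then have "L2_norm \<mu> (T (\<lambda>x. g x - u n x)) = L2_norm \<mu> (T g)"
      using g d by (intro L2_norm_cong L2_measurable T_L2) auto
    then show ?thesis using C[OF d] by simp
  qed
  moreover have "(\<lambda>n. C * L2_norm \<mu> (\<lambda>x. g x - u n x)) \<longlonglongrightarrow> C * 0"
    by (intro tendsto_intros lim)
  ultimately have "L2_norm \<mu> (T g) \<le> 0"
    by (intro LIMSEQ_le_const[where X = "\<lambda>n. C * L2_norm \<mu> (\<lambda>x. g x - u n x)"]) auto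
  then have "L2_norm \<mu> (T g) = 0" by (simp add: L2_norm_nonneg antisym)
  then show ?thesis using g by (simp add: L2_ker_def L2_norm_eq_0 T_L2)
qed

section \<open>The orthogonal complement of the kernel and the projection onto it\<close>

lemma orth_L2: "g \<in> N \<Longrightarrow> g \<in> L2 \<mu>"
  by (simp add: L2_orth_def)

lemma orth_inner: "g \<in> N \<Longrightarrow> k \<in> K \<Longrightarrow> L2_inner \<mu> k g = 0"
  by (simp add: L2_orth_def)

lemma orth_add: "g \<in> N \<Longrightarrow> h \<in> N \<Longrightarrow> (\<lambda>x. g x + h x) \<in> N"
  by (simp add: L2_orth_def L2_add L2_inner_add_right ker_L2)

lemma orth_scale: "g \<in> N \<Longrightarrow> (\<lambda>x. c * g x) \<in> N"
  by (simp add: L2_orth_def L2_scale L2_inner_scale_right)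

lemma orth_diff: "u \<in> N \<Longrightarrow> v \<in> N \<Longrightarrow> (\<lambda>x. u x - v x) \<in> N"
  using orth_add[OF _ orth_scale[of v "-1"], of u] by simp

lemma ker_orth_ae_0:
  assumes "f \<in> K" "f \<in> N"
  shows "ae_eq \<mu> f (\<lambda>x. 0)"
  using orth_inner[OF assms(2,1)] ker_L2[OF assms(1)] by (simp add: L2_inner_self L2_norm_eq_0)

text \<open>\<open>SOME\<close> only promises that \<open>f - P f\<close> is orthogonal to
  \<open>N\<close>; membership in \<open>K\<close> comes by comparison with the decomposition by
  \<open>k\<close>. The difference \<open>(f - k) - P f\<close> lies in \<open>N\<close> and equals
  \<open>(f - P f) - k\<close>, where both terms are orthogonal to \<open>N\<close>, so it is
  orthogonal to itself and null.\<close>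

lemma proj_orth:
  assumes f: "f \<in> L2 \<mu>"
  shows "P f \<in> N" and "(\<lambda>x. f x - P f x) \<in> K"
proof -
  obtain k where k: "k \<in> K" "(\<lambda>x. f x - k x) \<in> N"
  proof (rule L2_orthogonal_decomposition[of K \<mu> f])
    show "(\<lambda>x. 0) \<in> K" by (intro ker_ae_0 L2_zero ae_eq_refl)
  qed (auto intro: ker_L2 ker_add ker_scale ker_closed f)
  have "k \<in> L2_orth \<mu> N"
    using k(1) by (simp add: L2_orth_def[of \<mu> N] ker_L2 L2_inner_cnj[of \<mu> _ k] orth_inner)
  then have "\<exists>g. g \<in> N \<and> (\<lambda>x. f x - g x) \<in> L2_orth \<mu> N"
    using k(2) by (intro exI[of _ "\<lambda>x. f x - k x"]) simp
  then have P: "P f \<in> N" "(\<lambda>x. f x - P f x) \<in> L2_orth \<mu> N"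
    unfolding L2_proj_def by (rule someI2_ex, blast)+
  let ?d = "\<lambda>x. (f x - k x) - P f x"
  have dN: "?d \<in> N" using k(2) P(1) by (rule orth_diff)
  have dL: "?d \<in> L2 \<mu>" using dN by (rule orth_L2)
  have PL: "(\<lambda>x. f x - P f x) \<in> L2 \<mu>" using P(2) by (simp add: L2_orth_def[of \<mu> N])
  have "L2_inner \<mu> ?d (\<lambda>x. (f x - P f x) + (-1) * k x)
      = L2_inner \<mu> ?d (\<lambda>x. f x - P f x) + L2_inner \<mu> ?d (\<lambda>x. (-1) * k x)"
    by (rule L2_inner_add_right[OF dL PL L2_scale[OF ker_L2[OF k(1)]]])
  also have "\<dots> = 0"
    using P(2) dN orth_inner[OF dN k(1)]
    by (simp only: L2_inner_scale_right L2_inner_cnj[of \<mu> ?d k]) (simp add: L2_orth_def[of \<mu> N])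
  finally have "L2_inner \<mu> ?d ?d = 0" by (simp add: algebra_simps)
  then have "?d \<in> K"
    using dL by (intro ker_ae_0) (simp_all add: L2_inner_self L2_norm_eq_0)
  from ker_add[OF this k(1)] show "(\<lambda>x. f x - P f x) \<in> K"
    by (simp add: algebra_simps)
  show "P f \<in> N" by (rule P(1))
qed

lemma proj_L2: "f \<in> L2 \<mu> \<Longrightarrow> P f \<in> L2 \<mu>"
  by (rule orth_L2[OF proj_orth(1)])

text \<open>Two candidates differ by an element of both \<open>K\<close> and \<open>N\<close>, hence
  by a null function. Well-definedness and linearity of the choice \<open>P\<close> up to
  \<open>ae_eq\<close> come from this.\<close>

lemma proj_unique:
  assumes "f \<in> L2 \<mu>" "g \<in> N" "(\<lambda>x. f x - g x) \<in> K"
  shows "ae_eq \<mu> (P f) g"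
proof -
  have "(\<lambda>x. (f x - g x) - (f x - P f x)) \<in> K"
    by (rule ker_diff[OF assms(3) proj_orth(2)[OF assms(1)]])
  then have "(\<lambda>x. P f x - g x) \<in> K" by simp
  moreover have "(\<lambda>x. P f x - g x) \<in> N"
    by (rule orth_diff[OF proj_orth(1)[OF assms(1)] assms(2)])
  ultimately have "ae_eq \<mu> (\<lambda>x. P f x - g x) (\<lambda>x. 0)" by (rule ker_orth_ae_0)
  then show ?thesis by (simp add: ae_eq_def)
qed

lemma proj_cong:
  assumes "f \<in> L2 \<mu>" "g \<in> L2 \<mu>" "ae_eq \<mu> f g"
  shows "ae_eq \<mu> (P f) (P g)"
proof (rule proj_unique)
  have "(\<lambda>x. f x - g x) \<in> K"
    using assms(3) by (intro ker_ae_0 L2_diff assms) (simp add: ae_eq_def)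
  from ker_add[OF this proj_orth(2)[OF assms(2)]] show "(\<lambda>x. f x - P g x) \<in> K" by simp
qed (use assms proj_orth in auto)

lemma proj_add:
  assumes "f \<in> L2 \<mu>" "g \<in> L2 \<mu>"
  shows "ae_eq \<mu> (P (\<lambda>x. f x + g x)) (\<lambda>x. P f x + P g x)"
proof (rule proj_unique)
  show "(\<lambda>x. f x + g x - (P f x + P g x)) \<in> K"
    using ker_add[OF assms[THEN proj_orth(2)]] by (simp add: algebra_simps)
qed (use assms in \<open>auto intro!: L2_add orth_add proj_orth\<close>)

lemma proj_scale:
  assumes "f \<in> L2 \<mu>"
  shows "ae_eq \<mu> (P (\<lambda>x. c * f x)) (\<lambda>x. c * P f x)"
proof (rule proj_unique)
  show "(\<lambda>x. c * f x - c * P f x) \<in> K"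
    using ker_scale[OF proj_orth(2)[OF assms], of c] by (simp add: algebra_simps)
qed (use assms in \<open>auto intro!: L2_scale orth_scale proj_orth\<close>)

text \<open>Pythagoras for \<open>f = (f - P f) + P f\<close>.\<close>

lemma proj_norm_le:
  assumes "f \<in> L2 \<mu>"
  shows "L2_norm \<mu> (P f) \<le> L2_norm \<mu> f"
proof (rule power2_le_imp_le)
  let ?k = "\<lambda>x. f x - P f x"
  have "(L2_norm \<mu> (\<lambda>x. ?k x + P f x))\<^sup>2 = (L2_norm \<mu> ?k)\<^sup>2 + (L2_norm \<mu> (P f))\<^sup>2"
    using orth_inner[OF proj_orth[OF assms]] L2_norm_sq_add[of ?k \<mu> "P f"] assms
    by (simp add: ker_L2 proj_orth proj_L2)
  then show "(L2_norm \<mu> (P f))\<^sup>2 \<le> (L2_norm \<mu> f)\<^sup>2" by simp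
qed (rule L2_norm_nonneg)

lemma T_proj:
  assumes "f \<in> L2 \<mu>"
  shows "ae_eq \<mu> (T f) (T (P f))"
proof -
  have "ae_eq \<mu> (T (\<lambda>x. P f x + (f x - P f x))) (\<lambda>x. T (P f) x + 0)"
    using assms
    by (intro ae_eq_trans[OF T_add ae_eq_add[OF ae_eq_refl ker_ae]]) (simp_all add: ker_L2 proj_orth proj_L2)
  then show ?thesis by simp
qed

lemma proj_T:
  assumes "h \<in> N"
  shows "ae_eq \<mu> (P (T h)) h"
proof (rule proj_unique)
  have h: "h \<in> L2 \<mu>" using assms by (rule orth_L2)
  have "ae_eq \<mu> (T (\<lambda>x. T h x - h x)) (\<lambda>x. T h x - T h x)"
    using h by (intro ae_eq_trans[OF T_diff ae_eq_diff[OF T_idem ae_eq_refl]] T_L2)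
  then show "(\<lambda>x. T h x - h x) \<in> K"
    using h by (simp add: L2_ker_def L2_diff T_L2)
  show "T h \<in> L2 \<mu>" using h by (rule T_L2)
qed (rule assms)

section \<open>The operators R and Q\<close>

abbreviation "W \<equiv> W_space \<mu> t T"
abbreviation "R \<equiv> R_op \<mu> t T"
abbreviation "Q \<equiv> Q_op t T"

lemma
  assumes "f \<in> L2 \<mu>"
  shows mult_t_L2: "(\<lambda>x. t x * f x) \<in> L2 \<mu>"
    and mult_t_norm: "L2_norm \<mu> (\<lambda>x. t x * f x) = L2_norm \<mu> f"
    and mult_cnj_t_L2: "(\<lambda>x. cnj (t x) * f x) \<in> L2 \<mu>"
    and mult_cnj_t_norm: "L2_norm \<mu> (\<lambda>x. cnj (t x) * f x) = L2_norm \<mu> f"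
proof -
  show "(\<lambda>x. t x * f x) \<in> L2 \<mu>" "L2_norm \<mu> (\<lambda>x. t x * f x) = L2_norm \<mu> f"
    using t_measurable t_unimodular assms by (rule L2_mult_unimodular)+
  have "(\<lambda>x. cnj (t x)) \<in> borel_measurable \<mu>" "AE x in \<mu>. cmod (cnj (t x)) = 1"
    using t_measurable t_unimodular by (auto intro: borel_measurable_cnj)
  from L2_mult_unimodular[OF this assms]
  show "(\<lambda>x. cnj (t x) * f x) \<in> L2 \<mu>" "L2_norm \<mu> (\<lambda>x. cnj (t x) * f x) = L2_norm \<mu> f" .
qed

lemma cnj_t_mult_t:
  assumes "ae_eq \<mu> f (\<lambda>x. t x * h x)"
  shows "ae_eq \<mu> (\<lambda>x. cnj (t x) * f x) h"
  using t_unimodular assms unfolding ae_eq_def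
proof eventually_elim
  case (elim x)
  have "cnj (t x) * t x = 1"
    using elim complex_norm_square[of "t x"] by (simp add: mult.commute)
  then show ?case using elim by (simp flip: mult.assoc)
qed

lemma W_L2: "f \<in> W \<Longrightarrow> f \<in> L2 \<mu>"
  by (simp add: W_space_def)

text \<open>Supplies the nonempty unit ball for the operator norm over \<open>W\<close>.\<close>

lemma zero_W: "(\<lambda>x. 0) \<in> W"
  unfolding W_space_def using orth_scale[OF proj_orth(1)[OF L2_zero], of 0]
  by (auto simp: L2_zero ae_eq_refl intro!: bexI[of _ "\<lambda>x. 0"])

lemma R_W: "f \<in> L2 \<mu> \<Longrightarrow> R f \<in> W"
  unfolding W_space_def R_op_def by (auto intro!: mult_t_L2 proj_L2 proj_orth ae_eq_refl)

lemma R_norm: "f \<in> L2 \<mu> \<Longrightarrow> L2_norm \<mu> (R f) \<le> L2_norm \<mu> f"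
  unfolding R_op_def by (simp add: mult_t_norm proj_L2 proj_norm_le)

lemma R_bounded: "L2_bounded_op \<mu> (L2 \<mu>) W R"
  unfolding L2_bounded_op_def
proof (intro conjI ballI allI impI exI[of _ 1])
  fix f g assume f: "f \<in> L2 \<mu>" and g: "g \<in> L2 \<mu>"
  show "ae_eq \<mu> (R f) (R g)" if "ae_eq \<mu> f g"
    unfolding R_op_def using f g that by (intro ae_eq_mult proj_cong)
  show "ae_eq \<mu> (R (\<lambda>x. f x + g x)) (\<lambda>x. R f x + R g x)"
    using ae_eq_mult[OF proj_add[OF f g], of t] unfolding R_op_def by (simp add: distrib_left)
next
  fix f c assume f: "f \<in> L2 \<mu>"
  show "ae_eq \<mu> (R (\<lambda>x. c * f x)) (\<lambda>x. c * R f x)"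
    using ae_eq_mult[OF proj_scale[OF f], of t c] unfolding R_op_def by (simp add: mult_ac)
qed (simp_all add: R_W R_norm)

lemma Q_range: "f \<in> W \<Longrightarrow> Q f \<in> L2_range \<mu> T"
  unfolding L2_range_def Q_op_def
  using T_L2[OF mult_cnj_t_L2[OF W_L2]] mult_cnj_t_L2[OF W_L2] ae_eq_refl by blast

lemma Q_bounded: "L2_bounded_op \<mu> W (L2_range \<mu> T) Q"
proof (rule L2_bounded_op_restrict[of \<mu> "L2 \<mu>" "L2 \<mu>"])
  obtain C where C: "\<And>f. f \<in> L2 \<mu> \<Longrightarrow> L2_norm \<mu> (T f) \<le> C * L2_norm \<mu> f"
    using T_bounded unfolding L2_bounded_op_def by blast
  show "L2_bounded_op \<mu> (L2 \<mu>) (L2 \<mu>) Q"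
    unfolding L2_bounded_op_def
  proof (intro conjI ballI allI impI exI[of _ C])
    fix f g assume f: "f \<in> L2 \<mu>" and g: "g \<in> L2 \<mu>"
    show "ae_eq \<mu> (Q f) (Q g)" if "ae_eq \<mu> f g"
      unfolding Q_op_def using f g that by (intro T_cong mult_cnj_t_L2 ae_eq_mult)
    show "ae_eq \<mu> (Q (\<lambda>x. f x + g x)) (\<lambda>x. Q f x + Q g x)"
      using T_add[OF mult_cnj_t_L2[OF f] mult_cnj_t_L2[OF g]]
      unfolding Q_op_def by (simp add: distrib_left)
  next
    fix f c assume f: "f \<in> L2 \<mu>"
    show "ae_eq \<mu> (Q (\<lambda>x. c * f x)) (\<lambda>x. c * Q f x)"
      using T_scale[OF mult_cnj_t_L2[OF f], of c] unfolding Q_op_def by (simp add: mult_ac)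
    show "Q f \<in> L2 \<mu>" "L2_norm \<mu> (Q f) \<le> C * L2_norm \<mu> f"
      using f C[OF mult_cnj_t_L2[OF f]]
      unfolding Q_op_def by (simp_all add: T_L2 mult_cnj_t_L2 mult_cnj_t_norm)
  qed
qed (auto intro: W_L2 Q_range)

lemma Q_R:
  assumes f: "f \<in> L2 \<mu>"
  shows "ae_eq \<mu> (T f) (Q (R f))"
proof -
  have "ae_eq \<mu> (\<lambda>x. cnj (t x) * R f x) (P f)"
    by (rule cnj_t_mult_t) (simp add: R_op_def ae_eq_refl)
  then have "ae_eq \<mu> (Q (R f)) (T (P f))"
    unfolding Q_op_def using f by (intro T_cong) (simp_all add: mult_cnj_t_L2 W_L2 R_W proj_L2)
  then show ?thesis
    by (rule ae_eq_trans[OF T_proj[OF f] ae_eq_sym])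
qed

text \<open>A function of \<open>W\<close> is \<open>t h\<close> with \<open>h\<close> in
  \<open>N\<close>; \<open>Q\<close> strips \<open>t\<close> and applies \<open>T\<close>, after
  which \<open>P (T h) = h\<close> and \<open>R\<close> restores the factor
  \<open>t\<close>.\<close>

lemma R_Q:
  assumes f: "f \<in> W"
  shows "ae_eq \<mu> (R (Q f)) f"
proof -
  obtain h where h: "h \<in> N" "ae_eq \<mu> f (\<lambda>x. t x * h x)"
    using f unfolding W_space_def by blast
  have "ae_eq \<mu> (Q f) (T h)"
    unfolding Q_op_def using f h by (intro T_cong cnj_t_mult_t mult_cnj_t_L2 W_L2 orth_L2)
  then have "ae_eq \<mu> (P (Q f)) (P (T h))"
    using f h(1) unfolding Q_op_def
    by (intro proj_cong T_L2 mult_cnj_t_L2 W_L2 orth_L2)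
  from ae_eq_trans[OF this proj_T[OF h(1)]]
  have "ae_eq \<mu> (R (Q f)) (\<lambda>x. t x * h x)"
    unfolding R_op_def by (rule ae_eq_mult)
  then show ?thesis using h(2) by (rule ae_eq_trans[OF _ ae_eq_sym])
qed

text \<open>\<open>T = Q R\<close> with the contraction \<open>R\<close> gives one inequality. For
  the other, \<open>Q f\<close> is \<open>T\<close> at \<open>cnj t * f\<close>, a function of the
  same norm as \<open>f\<close>.\<close>

lemma opnorm_eq: "L2_opnorm \<mu> (L2 \<mu>) T = L2_opnorm \<mu> W Q"
proof (rule antisym)
  show "L2_opnorm \<mu> (L2 \<mu>) T \<le> L2_opnorm \<mu> W Q"
  proof (rule L2_opnorm_least[OF L2_zero])
    fix f assume f: "f \<in> L2 \<mu>" "L2_norm \<mu> f \<le> 1"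
    have "L2_norm \<mu> (T f) = L2_norm \<mu> (Q (R f))"
      using Q_R[OF f(1)] by (rule L2_norm_cong)
        (use f in \<open>simp_all add: Q_op_def L2_measurable T_L2 mult_cnj_t_L2 W_L2 R_W\<close>)
    also have "\<dots> \<le> L2_opnorm \<mu> W Q"
      using Q_bounded R_W[OF f(1)] order_trans[OF R_norm[OF f(1)] f(2)] by (rule L2_opnorm_upper)
    finally show "L2_norm \<mu> (T f) \<le> L2_opnorm \<mu> W Q" .
  qed (simp add: L2_norm_def)
  show "L2_opnorm \<mu> W Q \<le> L2_opnorm \<mu> (L2 \<mu>) T"
  proof (rule L2_opnorm_least[OF zero_W])
    fix f assume f: "f \<in> W" "L2_norm \<mu> f \<le> 1"
    show "L2_norm \<mu> (Q f) \<le> L2_opnorm \<mu> (L2 \<mu>) T"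
      unfolding Q_op_def
      using T_bounded mult_cnj_t_L2[OF W_L2[OF f(1)]] f(2)
      by (intro L2_opnorm_upper) (simp_all add: mult_cnj_t_norm W_L2[OF f(1)])
  qed (simp add: L2_norm_def)
qed

text \<open>The inverse is \<open>R\<close> restricted to the range of \<open>T\<close>: there
  \<open>Q (R h) = T h = h\<close> by idempotence.\<close>

lemma Q_invertible: "L2_invertible \<mu> W (L2_range \<mu> T) Q"
  unfolding L2_invertible_def
proof (intro conjI exI[of _ R] ballI Q_bounded R_Q)
  show "L2_bounded_op \<mu> (L2_range \<mu> T) W R"
    by (rule L2_bounded_op_restrict[OF R_bounded]) (auto simp: L2_range_def R_W)
next
  fix h assume "h \<in> L2_range \<mu> T"
  then obtain f where h: "h \<in> L2 \<mu>" and f: "f \<in> L2 \<mu>" "ae_eq \<mu> h (T f)"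
    by (auto simp: L2_range_def)
  have "ae_eq \<mu> (T h) (T (T f))" using h f by (intro T_cong T_L2)
  then have "ae_eq \<mu> (T h) h"
    by (metis T_idem[OF f(1)] ae_eq_trans ae_eq_sym[OF f(2)])
  then show "ae_eq \<mu> (Q (R h)) h"
    by (rule ae_eq_trans[OF ae_eq_sym[OF Q_R[OF h]]])
qed

end

section \<open>Continuously differentiable functions and level sets\<close>

text \<open>\<open>Ck_on\<close> speaks of the chosen \<open>frechet_derivative\<close>; for the
  full filter \<open>at x\<close> the derivative is unique, so any explicit \<open>f'\<close> can
  stand for it.\<close>

lemma Ck_on_1I:
  assumes "\<And>x. x \<in> U \<Longrightarrow> (f has_derivative f' x) (at x)"
    and "\<And>v. continuous_on U (\<lambda>x. f' x v)"
  shows "Ck_on (Suc 0) U f"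
proof -
  have "frechet_derivative f (at x) = f' x" if "x \<in> U" for x
    using frechet_derivative_at[OF assms(1)[OF that]] by simp
  then have "continuous_on U (\<lambda>x. frechet_derivative f (at x) v)" for v
    using assms(2)[of v] by (subst continuous_on_cong) auto
  moreover have "f differentiable (at x)" if "x \<in> U" for x
    using assms(1)[OF that] by (rule differentiableI)
  ultimately show ?thesis by simp
qed

lemma Ck_on_1_has_derivative:
  assumes "Ck_on (Suc 0) U f" "x \<in> U"
  shows "(f has_derivative frechet_derivative f (at x)) (at x)"
  using assms by (simp add: frechet_derivative_works)

lemma Ck_on_1_continuous_deriv:
  "Ck_on (Suc 0) U f \<Longrightarrow> continuous_on U (\<lambda>x. frechet_derivative f (at x) v)"
  by simp

lemma Ck_on_1_continuous:
  assumes "Ck_on (Suc 0) U f"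
  shows "continuous_on U f"
  by (rule has_derivative_continuous_on[OF has_derivative_at_withinI[OF Ck_on_1_has_derivative[OF assms]]])

lemma Ck_on_1_mono:
  assumes "Ck_on (Suc 0) U f" "V \<subseteq> U"
  shows "Ck_on (Suc 0) V f"
proof (rule Ck_on_1I)
  show "(f has_derivative frechet_derivative f (at x)) (at x)" if "x \<in> V" for x
    using Ck_on_1_has_derivative[OF assms(1)] assms(2) that by blast
  show "continuous_on V (\<lambda>x. frechet_derivative f (at x) v)" for v
    using Ck_on_1_continuous_deriv[OF assms(1)] assms(2) by (rule continuous_on_subset)
qed

lemma Ck_on_1_cong:
  assumes "Ck_on (Suc 0) U f" "open U" "\<And>x. x \<in> U \<Longrightarrow> g x = f x"
  shows "Ck_on (Suc 0) U g"
proof (rule Ck_on_1I[OF _ Ck_on_1_continuous_deriv[OF assms(1)]])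
  fix x assume x: "x \<in> U"
  show "(g has_derivative frechet_derivative f (at x)) (at x)"
    by (rule has_derivative_transform_within_open[OF Ck_on_1_has_derivative[OF assms(1) x] assms(2) x])
       (simp add: assms(3))
qed

lemma Ck_on_1_bounded_linear: "bounded_linear f \<Longrightarrow> Ck_on (Suc 0) U f"
  by (rule Ck_on_1I[where f' = "\<lambda>x. f"]) (auto intro: bounded_linear_imp_has_derivative)

lemma Ck_on_1_const: "Ck_on (Suc 0) U (\<lambda>x. c)"
  by (rule Ck_on_1I[where f' = "\<lambda>x v. 0"]) auto

lemma Ck_on_1_add:
  assumes "Ck_on (Suc 0) U f" "Ck_on (Suc 0) U g"
  shows "Ck_on (Suc 0) U (\<lambda>x. f x + g x)"
proof (rule Ck_on_1I)
  show "((\<lambda>x. f x + g x) has_derivative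
      (\<lambda>v. frechet_derivative f (at x) v + frechet_derivative g (at x) v)) (at x)" if "x \<in> U" for x
    by (intro has_derivative_add Ck_on_1_has_derivative[OF _ that] assms)
qed (intro continuous_on_add assms[THEN Ck_on_1_continuous_deriv])

lemma Ck_on_1_diff:
  assumes "Ck_on (Suc 0) U f" "Ck_on (Suc 0) U g"
  shows "Ck_on (Suc 0) U (\<lambda>x. f x - g x)"
proof (rule Ck_on_1I)
  show "((\<lambda>x. f x - g x) has_derivative
      (\<lambda>v. frechet_derivative f (at x) v - frechet_derivative g (at x) v)) (at x)" if "x \<in> U" for x
    by (intro has_derivative_diff Ck_on_1_has_derivative[OF _ that] assms)
qed (intro continuous_on_diff assms[THEN Ck_on_1_continuous_deriv])

lemma Ck_on_1_mult:
  fixes f g :: "'a::euclidean_space \<Rightarrow> 'b::real_normed_algebra"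
  assumes "Ck_on (Suc 0) U f" "Ck_on (Suc 0) U g"
  shows "Ck_on (Suc 0) U (\<lambda>x. f x * g x)"
proof (rule Ck_on_1I)
  show "((\<lambda>x. f x * g x) has_derivative
      (\<lambda>v. f x * frechet_derivative g (at x) v + frechet_derivative f (at x) v * g x)) (at x)"
    if "x \<in> U" for x
    by (intro has_derivative_mult Ck_on_1_has_derivative[OF _ that] assms)
qed (intro continuous_on_add continuous_on_mult assms[THEN Ck_on_1_continuous_deriv]
      assms[THEN Ck_on_1_continuous])

lemma Ck_on_1_divide:
  fixes f g :: "'a::euclidean_space \<Rightarrow> 'b::real_normed_field"
  assumes "Ck_on (Suc 0) U f" "Ck_on (Suc 0) U g" "\<And>x. x \<in> U \<Longrightarrow> g x \<noteq> 0"
  shows "Ck_on (Suc 0) U (\<lambda>x. f x / g x)"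
proof (rule Ck_on_1I)
  show "((\<lambda>x. f x / g x) has_derivative
      (\<lambda>v. (frechet_derivative f (at x) v * g x - f x * frechet_derivative g (at x) v) / (g x * g x)))
      (at x)" if "x \<in> U" for x
    by (rule has_derivative_divide'[OF Ck_on_1_has_derivative[OF assms(1) that]
          Ck_on_1_has_derivative[OF assms(2) that] assms(3)[OF that]])
  show "continuous_on U (\<lambda>x. (frechet_derivative f (at x) v * g x - f x * frechet_derivative g (at x) v)
      / (g x * g x))" for v
    by (intro continuous_on_divide continuous_on_diff continuous_on_mult
         assms(1,2)[THEN Ck_on_1_continuous_deriv] assms(1,2)[THEN Ck_on_1_continuous])
       (simp add: assms(3))
qed

lemma Ck_on_1_of_real:
  fixes f :: "'a::euclidean_space \<Rightarrow> real"
  assumes "Ck_on (Suc 0) U f"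
  shows "Ck_on (Suc 0) U (\<lambda>x. of_real (f x) :: complex)"
proof (rule Ck_on_1I)
  show "((\<lambda>x. of_real (f x) :: complex) has_derivative
      (\<lambda>v. of_real (frechet_derivative f (at x) v))) (at x)" if "x \<in> U" for x
    by (intro has_derivative_of_real Ck_on_1_has_derivative[OF _ that] assms)
qed (intro continuous_on_of_real assms[THEN Ck_on_1_continuous_deriv])

lemmas Ck_on_1_intros = Ck_on_1_const Ck_on_1_add Ck_on_1_diff Ck_on_1_mult

text \<open>\<open>Ck_on\<close> gives continuity only in each fixed direction; expanding
  \<open>v x\<close> in the finite basis reduces moving directions to that.\<close>

lemma Ck_on_1_continuous_directional:
  fixes f :: "'a::euclidean_space \<Rightarrow> 'b::real_normed_vector"
  assumes f: "Ck_on (Suc 0) U f" and S: "S \<subseteq> U" and v: "continuous_on S v"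
  shows "continuous_on S (\<lambda>x. frechet_derivative f (at x) (v x))"
proof -
  have "frechet_derivative f (at x) (v x)
      = (\<Sum>b\<in>Basis. (v x \<bullet> b) *\<^sub>R frechet_derivative f (at x) b)" if "x \<in> S" for x
  proof -
    have lin: "linear (frechet_derivative f (at x))"
      using f S that by (intro linear_frechet_derivative) auto
    have "frechet_derivative f (at x) (v x)
        = frechet_derivative f (at x) (\<Sum>b\<in>Basis. (v x \<bullet> b) *\<^sub>R b)"
      by (simp add: euclidean_representation)
    also have "\<dots> = (\<Sum>b\<in>Basis. (v x \<bullet> b) *\<^sub>R frechet_derivative f (at x) b)"
      by (simp add: linear_sum[OF lin] linear_cmul[OF lin])
    finally show ?thesis .
  qed
  moreover have "continuous_on S (\<lambda>x. \<Sum>b\<in>Basis. (v x \<bullet> b) *\<^sub>R frechet_derivative f (at x) b)"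
    by (intro continuous_intros v continuous_on_subset[OF Ck_on_1_continuous_deriv[OF f] S])
  ultimately show ?thesis by (subst continuous_on_cong[OF refl]) auto
qed

text \<open>To first order \<open>\<rho>\<close> equals \<open>t * s\<close> at
  \<open>\<zeta> + t (v + s n)\<close>, so it changes sign between \<open>s = - \<epsilon>\<close>
  and \<open>s = \<epsilon>\<close>, and the intermediate value theorem gives a zero. This takes the
  place of an implicit function theorem.\<close>

lemma level_set_tangent_approx:
  fixes \<rho> :: "'a::real_normed_vector \<Rightarrow> real"
  assumes d: "(\<rho> has_derivative \<rho>') (at \<zeta>)" and U: "open U" "\<zeta> \<in> U" "continuous_on U \<rho>"
    and z: "\<rho> \<zeta> = 0" and v: "\<rho>' v = 0" and n: "\<rho>' n = 1" and "\<epsilon> > 0" "\<delta> > 0"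
  obtains t s where "0 < t" "t < \<delta>" "\<bar>s\<bar> \<le> \<epsilon>" "\<zeta> + t *\<^sub>R (v + s *\<^sub>R n) \<in> U"
    "\<rho> (\<zeta> + t *\<^sub>R (v + s *\<^sub>R n)) = 0"
proof -
  define B where "B = norm v + \<epsilon> * norm n + 1"
  have B: "B > 0" using \<open>\<epsilon> > 0\<close> by (simp add: B_def add_nonneg_pos)
  have vB: "norm (v + s *\<^sub>R n) < B" if "\<bar>s\<bar> \<le> \<epsilon>" for s
    using norm_triangle_ineq[of v "s *\<^sub>R n"] mult_right_mono[OF that norm_ge_zero[of n]]
    by (simp add: B_def)
  have lin: "linear \<rho>'" using d by (rule has_derivative_linear)
  obtain r where r: "r > 0" "ball \<zeta> r \<subseteq> U" using U openE by blast
  \<comment> \<open>\<open>B\<close> bounds the length of all \<open>v + s n\<close>; the accuracy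
    \<open>\<epsilon> / (2 * B)\<close> keeps the remainder within
    \<open>\<epsilon> * t / 2\<close>, half of the leading term at the endpoints.\<close>
  have "\<epsilon> / (2 * B) > 0" using B \<open>\<epsilon> > 0\<close> by simp
  then obtain d where d: "d > 0" "\<And>y. norm (y - \<zeta>) < d \<Longrightarrow>
      norm (\<rho> y - \<rho> \<zeta> - \<rho>' (y - \<zeta>)) \<le> \<epsilon> / (2 * B) * norm (y - \<zeta>)"
    using d unfolding has_derivative_at_alt by blast
  define t where "t = min \<delta> (min r d / B) / 2"
  have t: "0 < t" "t < \<delta>" "t * B < r" "t * B < d"
    using B \<open>\<delta> > 0\<close> r(1) d(1) by (auto simp: t_def min_def field_simps)
  let ?y = "\<lambda>s. \<zeta> + t *\<^sub>R (v + s *\<^sub>R n)"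
  have y: "norm (?y s - \<zeta>) < t * B" if "\<bar>s\<bar> \<le> \<epsilon>" for s
    using vB[OF that] t(1) by simp
  have yU: "?y s \<in> U" if "\<bar>s\<bar> \<le> \<epsilon>" for s
    using y[OF that] t(3) r(2) by (auto simp: dist_norm norm_minus_commute)
  have est: "\<bar>\<rho> (?y s) - t * s\<bar> \<le> \<epsilon> * t / 2" if "\<bar>s\<bar> \<le> \<epsilon>" for s
  proof -
    have "\<rho>' (?y s - \<zeta>) = t * s"
      using v n by (simp add: linear_cmul[OF lin] linear_add[OF lin])
    then have "\<bar>\<rho> (?y s) - t * s\<bar> \<le> \<epsilon> / (2 * B) * norm (?y s - \<zeta>)"
      using d(2)[of "?y s"] y[OF that] t(4) z by simp
    also have "\<dots> \<le> \<epsilon> / (2 * B) * (t * B)"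
      using y[OF that] B \<open>\<epsilon> > 0\<close> by (intro mult_left_mono) auto
    finally show ?thesis using B by simp
  qed
  have "\<rho> (?y (- \<epsilon>)) \<le> 0" "0 \<le> \<rho> (?y \<epsilon>)"
    using abs_le_D1[OF est[of "- \<epsilon>"]] abs_le_D2[OF est[of \<epsilon>]] \<open>\<epsilon> > 0\<close> mult_pos_pos[OF \<open>\<epsilon> > 0\<close> t(1)]
    by (simp_all add: mult.commute[of t])
  moreover have "continuous_on {- \<epsilon>..\<epsilon>} (\<lambda>s. \<rho> (?y s))"
    by (rule continuous_on_compose2[OF U(3)]) (auto intro!: continuous_intros yU)
  ultimately obtain s where "- \<epsilon> \<le> s" "s \<le> \<epsilon>" "\<rho> (?y s) = 0"
    using IVT'[of "\<lambda>s. \<rho> (?y s)" "- \<epsilon>" 0 \<epsilon>] \<open>\<epsilon> > 0\<close> by auto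
  then show thesis using t yU[of s] by (intro that[of t s]) auto
qed

text \<open>Derivatives within a hypersurface are not unique as linear maps, but they agree on tangent
  vectors, because these are limits of secant directions.\<close>

lemma has_derivative_within_level_set_unique:
  fixes \<rho> :: "'a::real_normed_vector \<Rightarrow> real" and f :: "'a \<Rightarrow> 'b::real_normed_vector"
  assumes d: "(\<rho> has_derivative \<rho>') (at \<zeta>)" and U: "open U" "\<zeta> \<in> U" "continuous_on U \<rho>"
    and z: "\<rho> \<zeta> = 0" and nz: "\<rho>' \<noteq> (\<lambda>v. 0)" and v: "\<rho>' v = 0"
    and A: "(f has_derivative A) (at \<zeta> within {x\<in>U. \<rho> x = 0})"
    and B: "(f has_derivative B) (at \<zeta> within {x\<in>U. \<rho> x = 0})"
  shows "A v = B v"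
proof -
  define C where "C x = A x - B x" for x
  have C: "((\<lambda>x. f x - f x) has_derivative C) (at \<zeta> within {x\<in>U. \<rho> x = 0})"
    unfolding C_def by (intro has_derivative_diff A B)
  then have linC: "linear C" by (rule has_derivative_linear)
  have lin: "linear \<rho>'" using d by (rule has_derivative_linear)
  obtain n0 where "\<rho>' n0 \<noteq> 0" using nz by auto
  then have n: "\<rho>' (n0 /\<^sub>R \<rho>' n0) = 1" by (simp add: linear_cmul[OF lin])
  define n where "n = n0 /\<^sub>R \<rho>' n0"
  define b where "b = norm v + norm n + norm (C n)"
  \<comment> \<open>\<open>C\<close> is a derivative of the zero function within the level set, so
    it is small along secants. The same \<open>e\<close> serves as accuracy of this derivative and
    as bound on the tilt \<open>s\<close> of the secant direction.\<close>
  have "norm (C v) \<le> 0 + e * b" if e: "0 < e" "e < 1" for e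
  proof -
    obtain \<delta> where \<delta>: "\<delta> > 0" "\<And>y. y \<in> U \<Longrightarrow> \<rho> y = 0 \<Longrightarrow> norm (y - \<zeta>) < \<delta> \<Longrightarrow>
        norm (C (y - \<zeta>)) \<le> e * norm (y - \<zeta>)"
      using C e(1) unfolding has_derivative_within_alt by (auto simp: norm_minus_cancel)
    define c where "c = norm v + norm n + 1"
    have c: "c > 0" by (simp add: c_def add_nonneg_pos)
    obtain t s where ts: "0 < t" "t < \<delta> / c" "\<bar>s\<bar> \<le> e" "\<zeta> + t *\<^sub>R (v + s *\<^sub>R n) \<in> U"
        "\<rho> (\<zeta> + t *\<^sub>R (v + s *\<^sub>R n)) = 0"
      using level_set_tangent_approx[OF d U z v n[folded n_def] e(1), of "\<delta> / c"] c \<delta>(1) by auto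
    have "norm (s *\<^sub>R n) \<le> e * norm n"
      using ts(3) by (simp add: mult_right_mono)
    moreover have "e * norm n \<le> norm n" using e by (simp add: mult_left_le_one_le)
    ultimately have le: "norm (v + s *\<^sub>R n) \<le> norm v + norm n"
      using norm_triangle_ineq[of v "s *\<^sub>R n"] by linarith
    have "norm (t *\<^sub>R (v + s *\<^sub>R n)) \<le> t * c"
      using le ts(1) by (simp add: c_def)
    also have "\<dots> < \<delta>" using ts(2) c by (simp add: field_simps)
    finally have "norm (C (t *\<^sub>R (v + s *\<^sub>R n))) \<le> e * norm (t *\<^sub>R (v + s *\<^sub>R n))"
      using \<delta>(2)[OF ts(4,5)] by simp
    then have "norm (C (v + s *\<^sub>R n)) \<le> e * norm (v + s *\<^sub>R n)"
      using ts(1) by (simp add: linear_cmul[OF linC] mult.left_commute)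
    also have "\<dots> \<le> e * (norm v + norm n)" using le e by (intro mult_left_mono) auto
    finally have 1: "norm (C v + s *\<^sub>R C n) \<le> e * (norm v + norm n)"
      by (simp add: linear_add[OF linC] linear_cmul[OF linC])
    have "norm (C v) \<le> norm (C v + s *\<^sub>R C n) + norm (s *\<^sub>R C n)"
      using norm_triangle_ineq4[of "C v + s *\<^sub>R C n" "s *\<^sub>R C n"] by simp
    also have "norm (s *\<^sub>R C n) \<le> e * norm (C n)" using ts(3) by (simp add: mult_right_mono)
    finally show ?thesis using 1 by (simp add: b_def distrib_left)
  qed
  then have "\<forall>\<^sub>F e in at_right 0. norm (C v) \<le> 0 + e * b"
    unfolding eventually_at_right_field by (intro exI[of _ 1]) auto
  moreover have "((\<lambda>e. 0 + e * b) \<longlongrightarrow> 0 + 0 * b) (at_right 0)"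
    by (intro tendsto_intros)
  ultimately have "norm (C v) \<le> 0 + 0 * b"
    by (intro tendsto_lowerbound) auto
  then show ?thesis by (simp add: C_def)
qed

section \<open>The density of \<open>\<nu>\<close>\<close>

text \<open>As a sum of linear maps, \<open>vector\<close> falls under the usual rules for
  continuity and derivatives.\<close>

lemma vector2_eq_axis: "(vector [a, b] :: complex^2) = axis 1 a + axis 2 b"
  by (simp add: vec_eq_iff forall_2 axis_def)

lemma bounded_linear_axis: "bounded_linear (axis i :: complex \<Rightarrow> complex^2)"
  by (intro linear_conv_bounded_linear[THEN iffD1] linearI) (simp_all add: vec_eq_iff axis_def)

lemma continuous_on_vector2:
  fixes f g :: "'a::topological_space \<Rightarrow> complex"
  assumes "continuous_on S f" "continuous_on S g"
  shows "continuous_on S (\<lambda>x. vector [f x, g x] :: complex^2)"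
  unfolding vector2_eq_axis
  by (intro continuous_on_add bounded_linear.continuous_on[OF bounded_linear_axis] assms)

lemma smooth_on_Ck_on_1: "smooth_on U \<rho> \<Longrightarrow> Ck_on (Suc 0) U \<rho>"
  unfolding smooth_on_def by blast

lemma smooth_on_Ck_on_1_deriv:
  assumes "smooth_on U \<rho>"
  shows "Ck_on (Suc 0) U (\<lambda>x. frechet_derivative \<rho> (at x) v)"
  using assms[unfolded smooth_on_def, rule_format, of "Suc (Suc 0)"]
  unfolding Ck_on.simps(2)[of "Suc 0"] by blast

lemma d_rho_eq:
  assumes "\<rho> differentiable (at \<zeta>)"
  shows "d_rho \<rho> j \<zeta> = (1/2) * (of_real (frechet_derivative \<rho> (at \<zeta>) (axis j 1))
      - \<i> * of_real (frechet_derivative \<rho> (at \<zeta>) (axis j \<i>)))"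
proof -
  have "((\<lambda>x. complex_of_real (\<rho> x)) has_derivative
      (\<lambda>v. of_real (frechet_derivative \<rho> (at \<zeta>) v))) (at \<zeta>)"
    using assms by (intro has_derivative_of_real) (simp add: frechet_derivative_works)
  from frechet_derivative_at[OF this] show ?thesis
    by (simp add: d_rho_def dz_def fun_eq_iff)
qed

lemma Ck_on_1_d_rho:
  assumes "open U" "smooth_on U \<rho>"
  shows "Ck_on (Suc 0) U (d_rho \<rho> j)"
proof (rule Ck_on_1_cong[OF _ assms(1) d_rho_eq])
  show "Ck_on (Suc 0) U (\<lambda>\<zeta>. (1/2) * (complex_of_real (frechet_derivative \<rho> (at \<zeta>) (axis j 1))
      - \<i> * of_real (frechet_derivative \<rho> (at \<zeta>) (axis j \<i>))))"
    by (intro Ck_on_1_intros Ck_on_1_of_real smooth_on_Ck_on_1_deriv assms)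
  show "\<rho> differentiable (at \<zeta>)" if "\<zeta> \<in> U" for \<zeta>
    using Ck_on_1_has_derivative[OF smooth_on_Ck_on_1[OF assms(2)] that] by (rule differentiableI)
qed

text \<open>As \<open>\<rho>\<close> is real, the (0,1) part of its differential is the conjugate of
  the (1,0) part, so the differential is twice the real part of the latter.\<close>

lemma frechet_derivative_eq_d_rho:
  assumes "\<rho> differentiable (at \<zeta>)"
  shows "frechet_derivative \<rho> (at \<zeta>) v = 2 * Re (d_rho \<rho> 1 \<zeta> * v$1 + d_rho \<rho> 2 \<zeta> * v$2)"
proof -
  let ?D = "frechet_derivative \<rho> (at \<zeta>)"
  have lin: "linear ?D" using assms by (rule linear_frechet_derivative)
  have "v = (Re (v$1) *\<^sub>R axis 1 1 + Im (v$1) *\<^sub>R axis 1 \<i>)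
      + (Re (v$2) *\<^sub>R axis 2 1 + Im (v$2) *\<^sub>R axis 2 \<i>)"
    by (simp add: vec_eq_iff forall_2 axis_def complex_eq_iff)
  then have "?D v = ?D ((Re (v$1) *\<^sub>R axis 1 1 + Im (v$1) *\<^sub>R axis 1 \<i>)
      + (Re (v$2) *\<^sub>R axis 2 1 + Im (v$2) *\<^sub>R axis 2 \<i>))"
    by (rule arg_cong)
  also have "\<dots> = (Re (v$1) * ?D (axis 1 1) + Im (v$1) * ?D (axis 1 \<i>))
      + (Re (v$2) * ?D (axis 2 1) + Im (v$2) * ?D (axis 2 \<i>))"
    by (simp only: linear_add[OF lin] linear_cmul[OF lin]) simp
  finally show ?thesis
    by (simp add: d_rho_eq[OF assms] algebra_simps)
qed

text \<open>The determinant of the admissibility condition with \<open>(d$2, - d$1)\<close> for the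
  vector \<open>\<mu>\<close>; with \<open>d\<close> as a free covector it is a polynomial in
  \<open>d\<close> and \<open>\<zeta>\<close>.\<close>

definition adm_det :: "complex^3^3 \<Rightarrow> complex^2 \<Rightarrow> complex^2 \<Rightarrow> complex" where
  "adm_det M d \<zeta> = (M$2$2 * d$2 - M$2$3 * d$1) * (M$3$2 * \<zeta>$1 + M$3$3 * \<zeta>$2 + M$3$1)
     - (M$2$2 * \<zeta>$1 + M$2$3 * \<zeta>$2 + M$2$1) * (M$3$2 * d$2 - M$3$3 * d$1)"

text \<open>Cramer's rule for the two linear equations expressing that the line \<open>Phi M z w = 0\<close> passes
  through \<open>\<zeta>\<close> and has the direction \<open>(d\<^sub>2, -d\<^sub>1)\<close>.\<close>

definition dual_point1 :: "complex^3^3 \<Rightarrow> complex^2 \<Rightarrow> complex^2 \<Rightarrow> complex" where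
  "dual_point1 M d \<zeta> =
    ((M$1$1 + M$1$2 * \<zeta>$1 + M$1$3 * \<zeta>$2) * (M$3$2 * d$2 - M$3$3 * d$1)
     - (M$1$2 * d$2 - M$1$3 * d$1) * (M$3$2 * \<zeta>$1 + M$3$3 * \<zeta>$2 + M$3$1)) / adm_det M d \<zeta>"

definition dual_point2 :: "complex^3^3 \<Rightarrow> complex^2 \<Rightarrow> complex^2 \<Rightarrow> complex" where
  "dual_point2 M d \<zeta> =
    ((M$1$2 * d$2 - M$1$3 * d$1) * (M$2$2 * \<zeta>$1 + M$2$3 * \<zeta>$2 + M$2$1)
     - (M$1$1 + M$1$2 * \<zeta>$1 + M$1$3 * \<zeta>$2) * (M$2$2 * d$2 - M$2$3 * d$1)) / adm_det M d \<zeta>"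

text \<open>The coefficients \<open>p\<close> belong to incidence with the point and
  \<open>q\<close> to the direction; the sign of the determinant is fixed to agree with
  \<open>adm_det\<close>.\<close>

lemma cramer_2:
  fixes p1 :: "'a::field"
  assumes "q1 * p2 - p1 * q2 \<noteq> 0"
  shows "a + w1 * p1 + w2 * p2 = 0 \<and> b + w1 * q1 + w2 * q2 = 0 \<longleftrightarrow>
    w1 = (a * q2 - b * p2) / (q1 * p2 - p1 * q2) \<and> w2 = (b * p1 - a * q1) / (q1 * p2 - p1 * q2)"
    (is "?L \<longleftrightarrow> ?R")
proof
  assume L: ?L
  have "w1 * (q1 * p2 - p1 * q2) = a * q2 - b * p2" "w2 * (q1 * p2 - p1 * q2) = b * p1 - a * q1"
    using L by algebra+
  then show ?R using assms by (simp add: eq_divide_eq)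
next
  assume ?R
  then have "w1 * (q1 * p2 - p1 * q2) = a * q2 - b * p2" "w2 * (q1 * p2 - p1 * q2) = b * p1 - a * q1"
    using assms by (simp_all add: eq_divide_eq)
  then have "(a + w1 * p1 + w2 * p2) * (q1 * p2 - p1 * q2) = 0"
    "(b + w1 * q1 + w2 * q2) * (q1 * p2 - p1 * q2) = 0" by algebra+
  then show ?L using assms by simp
qed

lemma Phi_eq:
  "Phi M z w = (M$1$1 + M$1$2 * z$1 + M$1$3 * z$2)
     + w$1 * (M$2$2 * z$1 + M$2$3 * z$2 + M$2$1) + w$2 * (M$3$2 * z$1 + M$3$3 * z$2 + M$3$1)"
  by (simp add: Phi_def homog_def sum_3 algebra_simps)

lemma dual_point_iff:
  assumes "adm_det M d \<zeta> \<noteq> 0"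
  shows "w = vector [dual_point1 M d \<zeta>, dual_point2 M d \<zeta>] \<longleftrightarrow>
    Phi M \<zeta> w = 0 \<and>
    (M$1$2 * d$2 - M$1$3 * d$1) + w$1 * (M$2$2 * d$2 - M$2$3 * d$1) + w$2 * (M$3$2 * d$2 - M$3$3 * d$1) = 0"
  using cramer_2[OF assms[unfolded adm_det_def]]
  by (simp add: vec_eq_iff forall_2 Phi_eq dual_point1_def dual_point2_def adm_det_def)

text \<open>An affine line is fixed by a point and a direction, and both conditions are linear in
  \<open>w\<close>. As an equivalence for every \<open>w\<close>, this yields existence and
  uniqueness for the \<open>THE\<close> in \<open>w_map\<close> together. Invertibility of
  \<open>M\<close> prevents \<open>Phi M z w = 0\<close> from degenerating to the whole
  plane.\<close>

lemma line_eq_iff_dual_point: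
  assumes M: "invertible M" and d: "d \<noteq> 0" and nz: "adm_det M d \<zeta> \<noteq> 0"
  shows "{z. d$1 * (z$1 - \<zeta>$1) + d$2 * (z$2 - \<zeta>$2) = 0} = {z. Phi M z w = 0} \<longleftrightarrow>
    w = vector [dual_point1 M d \<zeta>, dual_point2 M d \<zeta>]" (is "?T = ?P \<longleftrightarrow> _")
proof -
  define B where "B j = M$1$j + w$1 * M$2$j + w$2 * M$3$j" for j
  have Phi: "Phi M z w = B 1 + B 2 * z$1 + B 3 * z$2" for z
    by (simp add: Phi_eq B_def algebra_simps)
  have dual: "w = vector [dual_point1 M d \<zeta>, dual_point2 M d \<zeta>] \<longleftrightarrow>
      B 1 + B 2 * \<zeta>$1 + B 3 * \<zeta>$2 = 0 \<and> B 2 * d$2 = B 3 * d$1"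
    unfolding dual_point_iff[OF nz] Phi by (simp add: B_def algebra_simps)
  show ?thesis
  proof
    assume eq: "?T = ?P"
    have "\<zeta> \<in> ?T" "\<zeta> + vector [d$2, - d$1] \<in> ?T" by simp_all
    then have "B 1 + B 2 * \<zeta>$1 + B 3 * \<zeta>$2 = 0" "B 1 + B 2 * (\<zeta>$1 + d$2) + B 3 * (\<zeta>$2 - d$1) = 0"
      unfolding eq by (simp_all add: Phi)
    moreover from this have "B 2 * d$2 = B 3 * d$1" by algebra
    ultimately show "w = vector [dual_point1 M d \<zeta>, dual_point2 M d \<zeta>]"
      unfolding dual by blast
  next
    assume "w = vector [dual_point1 M d \<zeta>, dual_point2 M d \<zeta>]"
    then have B: "B 1 + B 2 * \<zeta>$1 + B 3 * \<zeta>$2 = 0" "B 2 * d$2 = B 3 * d$1"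
      unfolding dual by auto
    have B0: "B 2 \<noteq> 0 \<or> B 3 \<noteq> 0"
    proof (rule ccontr)
      assume "\<not> (B 2 \<noteq> 0 \<or> B 3 \<noteq> 0)"
      then have "B 1 = 0" "B 2 = 0" "B 3 = 0" using B(1) by auto
      \<comment> \<open>The first coordinate of \<open>homog w\<close> is \<open>1\<close>, so an
        invertible \<open>M\<close> cannot annihilate it.\<close>
      then have "homog w v* M = 0"
        by (simp add: vec_eq_iff forall_3 vector_matrix_mult_def homog_def sum_3 B_def algebra_simps)
      moreover obtain N where "M ** N = mat 1" using M by (auto simp: invertible_def)
      then have "(homog w v* M) v* N = homog w" by (simp add: vector_matrix_mul_assoc)
      ultimately have "homog w = 0" by simp
      then show False by (simp add: vec_eq_iff forall_3 homog_def)
    qed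
    obtain l where l: "B 2 = l * d$1" "B 3 = l * d$2"
    proof (cases "d$1 = 0")
      case True
      then have "d$2 \<noteq> 0" using d by (auto simp: vec_eq_iff forall_2)
      then show thesis using True B(2) by (intro that[of "B 3 / d$2"]) auto
    next
      case False
      then show thesis using B(2) by (intro that[of "B 2 / d$1"]) (auto simp: field_simps)
    qed
    have "l \<noteq> 0" using l B0 by auto
    have "Phi M z w = l * (d$1 * (z$1 - \<zeta>$1) + d$2 * (z$2 - \<zeta>$2))" for z
      using B(1) unfolding Phi l by algebra
    then show "?T = ?P" using \<open>l \<noteq> 0\<close> by auto
  qed
qed

lemma outer_normal_nth:
  "outer_normal \<rho> \<zeta> $ j = inverse (norm (\<chi> j. cnj (d_rho \<rho> j \<zeta>))) *\<^sub>R cnj (d_rho \<rho> j \<zeta>)"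
  by (simp add: outer_normal_def sgn_div_norm)

section \<open>Continuity of the density on an admissible hypersurface\<close>

locale admissible_hypersurface =
  fixes M :: "complex^3^3" and S \<Omega> U :: "(complex^2) set" and \<rho> :: "complex^2 \<Rightarrow> real"
  assumes M: "invertible M" and boundary: "smooth_boundary_of S \<Omega> U \<rho>"
    and adm: "admissible M S \<rho>"
begin

lemma open_U: "open U" and smooth: "smooth_on U \<rho>" and S_U: "S \<subseteq> U"
  and S_eq: "S = {\<zeta>\<in>U. \<rho> \<zeta> = 0}"
  and deriv_nz: "\<zeta> \<in> S \<Longrightarrow> frechet_derivative \<rho> (at \<zeta>) \<noteq> (\<lambda>v. 0)"
  using boundary unfolding smooth_boundary_of_def by blast+

definition "grad \<zeta> = (\<chi> j. d_rho \<rho> j \<zeta>)"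

text \<open>\<open>Ck_on\<close> uses ambient derivatives, so Cramer's quotients are treated as
  functions also off \<open>S\<close>, wherever their denominator is nonzero.\<close>

definition "V = {\<zeta>\<in>U. adm_det M (grad \<zeta>) \<zeta> \<noteq> 0}"

lemma \<rho>_deriv: "\<zeta> \<in> U \<Longrightarrow> (\<rho> has_derivative frechet_derivative \<rho> (at \<zeta>)) (at \<zeta>)"
  by (rule Ck_on_1_has_derivative[OF smooth_on_Ck_on_1[OF smooth]])

lemma \<rho>_deriv_eq:
  "\<zeta> \<in> U \<Longrightarrow> frechet_derivative \<rho> (at \<zeta>) v = 2 * Re (d_rho \<rho> 1 \<zeta> * v$1 + d_rho \<rho> 2 \<zeta> * v$2)"
  by (rule frechet_derivative_eq_d_rho[OF differentiableI[OF \<rho>_deriv]])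

lemma grad_nz:
  assumes "\<zeta> \<in> S"
  shows "grad \<zeta> \<noteq> 0"
proof
  assume "grad \<zeta> = 0"
  then have "d_rho \<rho> j \<zeta> = 0" for j by (simp add: grad_def vec_eq_iff)
  moreover have "\<zeta> \<in> U" using assms S_U by auto
  ultimately have "frechet_derivative \<rho> (at \<zeta>) = (\<lambda>v. 0)"
    by (simp add: fun_eq_iff \<rho>_deriv_eq)
  then show False using deriv_nz[OF assms] by simp
qed

lemma adm_det_nz: "\<zeta> \<in> S \<Longrightarrow> adm_det M (grad \<zeta>) \<zeta> \<noteq> 0"
  using adm unfolding admissible_def Let_def
  by (simp add: det_2 adm_det_def grad_def blk_def matrix_vector_mult_def sum_2)

lemma w_map_eq:
  assumes "\<zeta> \<in> S"
  shows "w_map M \<rho> \<zeta> = vector [dual_point1 M (grad \<zeta>) \<zeta>, dual_point2 M (grad \<zeta>) \<zeta>]"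
proof -
  have "complex_tangent_line \<rho> \<zeta>
      = {z. grad \<zeta> $ 1 * (z$1 - \<zeta>$1) + grad \<zeta> $ 2 * (z$2 - \<zeta>$2) = 0}"
    by (simp add: complex_tangent_line_def grad_def sum_2)
  then show ?thesis
    unfolding w_map_def
    by (simp add: line_eq_iff_dual_point[OF M grad_nz[OF assms] adm_det_nz[OF assms]])
qed

lemma Ck_on_1_grad: "Ck_on (Suc 0) U (\<lambda>\<zeta>. grad \<zeta> $ j)"
  unfolding grad_def by (simp only: vec_lambda_beta Ck_on_1_d_rho[OF open_U smooth])

lemma Ck_on_1_nth: "Ck_on (Suc 0) X (\<lambda>\<zeta>::complex^2. \<zeta> $ j)"
  by (intro Ck_on_1_bounded_linear bounded_linear_vec_nth)

lemma Ck_on_1_adm_det: "Ck_on (Suc 0) U (\<lambda>\<zeta>. adm_det M (grad \<zeta>) \<zeta>)"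
  unfolding adm_det_def by (intro Ck_on_1_intros Ck_on_1_grad Ck_on_1_nth)

lemma V_U: "V \<subseteq> U" and S_V: "S \<subseteq> V"
  using S_U adm_det_nz by (auto simp: V_def)

lemma Ck_on_1_dual_point:
  "Ck_on (Suc 0) V (\<lambda>\<zeta>. dual_point1 M (grad \<zeta>) \<zeta>)"
  "Ck_on (Suc 0) V (\<lambda>\<zeta>. dual_point2 M (grad \<zeta>) \<zeta>)"
  unfolding dual_point1_def dual_point2_def
  by (intro Ck_on_1_divide Ck_on_1_intros Ck_on_1_mono[OF Ck_on_1_grad V_U]
      Ck_on_1_mono[OF Ck_on_1_adm_det V_U] Ck_on_1_nth; simp add: V_def)+

abbreviation "w1 \<equiv> (\<lambda>\<zeta>. dual_point1 M (grad \<zeta>) \<zeta>)"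
abbreviation "w2 \<equiv> (\<lambda>\<zeta>. dual_point2 M (grad \<zeta>) \<zeta>)"

text \<open>On \<open>S\<close> the map \<open>w_map\<close> agrees with Cramer's formulas, so the
  chosen derivative and the ambient derivatives of \<open>w1\<close> and \<open>w2\<close> both
  differentiate it within \<open>S\<close>; on tangent vectors they must coincide.\<close>

lemma w_map_deriv:
  assumes "\<zeta> \<in> S" "frechet_derivative \<rho> (at \<zeta>) v = 0"
  shows "frechet_derivative (w_map M \<rho>) (at \<zeta> within S) v
    = vector [frechet_derivative w1 (at \<zeta>) v, frechet_derivative w2 (at \<zeta>) v]"
proof -
  have \<zeta>: "\<zeta> \<in> U" "\<zeta> \<in> V" "\<rho> \<zeta> = 0" using assms(1) S_U S_V S_eq by auto
  let ?A = "\<lambda>v. vector [frechet_derivative w1 (at \<zeta>) v, frechet_derivative w2 (at \<zeta>) v] :: complex^2"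
  have "((\<lambda>\<zeta>. vector [w1 \<zeta>, w2 \<zeta>] :: complex^2) has_derivative ?A) (at \<zeta> within S)"
    unfolding vector2_eq_axis
    by (intro has_derivative_add bounded_linear.has_derivative[OF bounded_linear_axis]
        has_derivative_at_withinI[OF Ck_on_1_has_derivative[OF Ck_on_1_dual_point(1) \<zeta>(2)]]
        has_derivative_at_withinI[OF Ck_on_1_has_derivative[OF Ck_on_1_dual_point(2) \<zeta>(2)]])
  then have A: "(w_map M \<rho> has_derivative ?A) (at \<zeta> within S)"
    by (rule has_derivative_transform[OF assms(1), rotated]) (rule w_map_eq)
  have "(w_map M \<rho> has_derivative frechet_derivative (w_map M \<rho>) (at \<zeta> within S)) (at \<zeta> within S)"
    by (rule frechet_derivative_works[THEN iffD1, OF differentiableI[OF A]])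
  from has_derivative_within_level_set_unique[OF \<rho>_deriv[OF \<zeta>(1)] open_U \<zeta>(1)
      Ck_on_1_continuous[OF smooth_on_Ck_on_1[OF smooth]] \<zeta>(3) deriv_nz[OF assms(1)] assms(2)
      this[unfolded S_eq] A[unfolded S_eq]]
  show ?thesis by (simp only: S_eq[symmetric])
qed

abbreviation "normal \<equiv> outer_normal \<rho>"
abbreviation "ctan \<zeta> \<equiv> vector [- cnj (normal \<zeta> $ 2), cnj (normal \<zeta> $ 1)] :: complex^2"

text \<open>\<open>normal\<close> is a real multiple of the conjugate of \<partial>\<rho>, so
  \<partial>\<rho> is purely imaginary on \<open>\<i> *s normal \<zeta>\<close>, and on
  \<open>ctan \<zeta>\<close> it vanishes already as a complex number.\<close>

lemma tangent:
  assumes "\<zeta> \<in> S"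
  shows "frechet_derivative \<rho> (at \<zeta>) (\<i> *s normal \<zeta>) = 0"
    "frechet_derivative \<rho> (at \<zeta>) (ctan \<zeta>) = 0"
    "frechet_derivative \<rho> (at \<zeta>) (\<i> *s ctan \<zeta>) = 0"
proof -
  have "\<zeta> \<in> U" using assms S_U by auto
  note eq = \<rho>_deriv_eq[OF this]
  show "frechet_derivative \<rho> (at \<zeta>) (\<i> *s normal \<zeta>) = 0"
    unfolding eq by (simp add: outer_normal_nth algebra_simps)
  show "frechet_derivative \<rho> (at \<zeta>) (ctan \<zeta>) = 0"
    "frechet_derivative \<rho> (at \<zeta>) (\<i> *s ctan \<zeta>) = 0"
    unfolding eq by (simp_all add: outer_normal_nth algebra_simps)
qed

lemma continuous_on_normal: "continuous_on S normal"
proof -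
  have "continuous_on S (\<lambda>\<zeta>. cnj (d_rho \<rho> j \<zeta>))" for j
    by (intro continuous_on_cnj continuous_on_subset[OF _ S_U]
        Ck_on_1_continuous[OF Ck_on_1_d_rho[OF open_U smooth]])
  moreover have "(\<chi> j. cnj (d_rho \<rho> j \<zeta>)) \<noteq> 0" if "\<zeta> \<in> S" for \<zeta>
    using grad_nz[OF that] by (simp add: vec_eq_iff grad_def)
  ultimately show ?thesis
    unfolding outer_normal_def by (intro continuous_on_sgn continuous_on_vec_lambda) auto
qed

lemma continuous_on_form_density: "continuous_on S (form_density \<rho> (nu_form M S \<rho>))"
proof -
  define e where "e = blk M *v vector [M$1$3, - M$1$2]"
  \<comment> \<open>The one-form factor of \<open>nu_form\<close> with ambient derivatives in place
    of the derivative within \<open>S\<close>; in \<open>eq\<close> it is evaluated on tangent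
    vectors only, where the two agree.\<close>
  define a where "a \<zeta> v = (frechet_derivative w1 (at \<zeta>) v * e$1 + frechet_derivative w2 (at \<zeta>) v * e$2)
      + det (blk M) * (w2 \<zeta> * frechet_derivative w1 (at \<zeta>) v - w1 \<zeta> * frechet_derivative w2 (at \<zeta>) v)" for \<zeta> v
  let ?w = "wedge11 (\<lambda>v::complex^2. v$1) (\<lambda>v. v$2)"
  have eq: "form_density \<rho> (nu_form M S \<rho>) \<zeta> = 1 / (2 * of_real pi * \<i>)\<^sup>2 *
      (a \<zeta> (\<i> *s normal \<zeta>) * ?w (ctan \<zeta>) (\<i> *s ctan \<zeta>)
        - a \<zeta> (ctan \<zeta>) * ?w (\<i> *s normal \<zeta>) (\<i> *s ctan \<zeta>)
        + a \<zeta> (\<i> *s ctan \<zeta>) * ?w (\<i> *s normal \<zeta>) (ctan \<zeta>))" if "\<zeta> \<in> S" for \<zeta>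
    unfolding form_density_def nu_form_def Let_def wedge12_def e_def[symmetric]
    by (simp only: w_map_deriv[OF that tangent(1)[OF that]] w_map_deriv[OF that tangent(2)[OF that]]
        w_map_deriv[OF that tangent(3)[OF that]] w_map_eq[OF that] vector_2 sum_2 a_def)
  have n: "continuous_on S (\<lambda>\<zeta>. normal \<zeta> $ j)" for j
    by (intro continuous_intros continuous_on_normal)
  have s: "\<i> *s normal \<zeta> = vector [\<i> * normal \<zeta> $ 1, \<i> * normal \<zeta> $ 2]"
    "\<i> *s ctan \<zeta> = vector [\<i> * (- cnj (normal \<zeta> $ 2)), \<i> * cnj (normal \<zeta> $ 1)]" for \<zeta>
    by (simp_all add: vec_eq_iff forall_2)
  have v: "continuous_on S (\<lambda>\<zeta>. \<i> *s normal \<zeta>)" "continuous_on S ctan"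
    "continuous_on S (\<lambda>\<zeta>. \<i> *s ctan \<zeta>)"
    unfolding s by (intro continuous_on_vector2 continuous_intros n)+
  have w: "continuous_on S w1" "continuous_on S w2"
    by (rule continuous_on_subset[OF Ck_on_1_continuous[OF Ck_on_1_dual_point(1)] S_V]
        continuous_on_subset[OF Ck_on_1_continuous[OF Ck_on_1_dual_point(2)] S_V])+
  have a: "continuous_on S (\<lambda>\<zeta>. a \<zeta> (u \<zeta>))" if "continuous_on S u" for u
    unfolding a_def
    by (intro continuous_intros w Ck_on_1_continuous_directional[OF Ck_on_1_dual_point(1) S_V that]
        Ck_on_1_continuous_directional[OF Ck_on_1_dual_point(2) S_V that])
  have ww: "continuous_on S (\<lambda>\<zeta>. ?w (u \<zeta>) (u' \<zeta>))" if "continuous_on S u" "continuous_on S u'" for u u'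
    unfolding wedge11_def by (intro continuous_intros that)
  show ?thesis
    by (subst continuous_on_cong[OF refl eq], assumption)
       (intro continuous_on_mult continuous_on_add continuous_on_diff continuous_on_const a ww v)
qed

text \<open>\<open>measure_of\<close> takes its sigma-algebra from the generating family, so
  \<open>surface_measure\<close> has the relative Borel sets, for which a function continuous on
  \<open>S\<close> is measurable.\<close>

lemma form_density_measurable:
  "form_density \<rho> (nu_form M S \<rho>) \<in> borel_measurable (surface_measure S)"
proof -
  have "sets (hausdorff_measure 3 :: (complex^2) measure) = sets borel"
    using sets.sigma_sets_eq[of "borel :: (complex^2) measure"] by (simp add: hausdorff_measure_def)
  then have "sets (surface_measure S) = sets (restrict_space borel S)"
    unfolding surface_measure_def by (rule sets_restrict_space_cong)
  then show ?thesis
    using borel_measurable_continuous_on_restrict[OF continuous_on_form_density]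
    by (simp cong: measurable_cong_sets)
qed

lemma tau_measurable: "tau M S \<rho> \<in> borel_measurable (nu_measure M S \<rho>)"
proof -
  have "tau M S \<rho> = (\<lambda>\<zeta>. sgn (form_density \<rho> (nu_form M S \<rho>) \<zeta>))"
    by (simp add: tau_def fun_eq_iff)
  then show ?thesis
    using measurable_compose[OF form_density_measurable borel_measurable_sgn]
    by (simp add: nu_measure_def)
qed

text \<open>Where the density vanishes \<open>tau\<close> is \<open>0\<close>, but such points are
  null for the measure that has this density.\<close>

lemma tau_unimodular: "AE \<zeta> in nu_measure M S \<rho>. cmod (tau M S \<rho> \<zeta>) = 1"
proof -
  have "(\<lambda>\<zeta>. ennreal (cmod (form_density \<rho> (nu_form M S \<rho>) \<zeta>))) \<in> borel_measurable (surface_measure S)"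
    using form_density_measurable by measurable
  then show ?thesis
    unfolding nu_measure_def by (subst AE_density) (auto simp: tau_def norm_sgn)
qed

end

theorem theorem5p6:
  fixes M :: "complex^3^3"
    and S \<Omega> U :: "(complex^2) set"
    and \<rho> :: "complex^2 \<Rightarrow> real"
    and L :: "(complex^2 \<Rightarrow> complex) \<Rightarrow> (complex^2 \<Rightarrow> complex)"
  assumes invertible_M: "invertible M"
    and boundary: "smooth_boundary_of S \<Omega> U \<rho>"
    and convex: "strongly_C_convex S \<rho>"
    and admissible: "admissible M S \<rho>"
    and leray: "leray_L2_operator (nu_measure M S \<rho>) S \<Omega> \<rho> L"
    and lanzani_stein_projection:
      "\<forall>f\<in>L2 (nu_measure M S \<rho>). ae_eq (nu_measure M S \<rho>) (L (L f)) (L f)"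
    and lanzani_stein_range:
      "L2_range (nu_measure M S \<rho>) L = hardy2 (nu_measure M S \<rho>) \<Omega> \<rho>"
  shows "let \<mu> = nu_measure M S \<rho>; \<tau> = tau M S \<rho>;
             W = W_space \<mu> \<tau> L; R = R_op \<mu> \<tau> L; Q = Q_op \<tau> L
         in L2_bounded_op \<mu> (L2 \<mu>) W R \<and>
            L2_bounded_op \<mu> W (hardy2 \<mu> \<Omega> \<rho>) Q \<and>
            (\<forall>f\<in>L2 \<mu>. ae_eq \<mu> (L f) (Q (R f))) \<and>
            L2_opnorm \<mu> (L2 \<mu>) L = L2_opnorm \<mu> W Q \<and>
            L2_invertible \<mu> W (hardy2 \<mu> \<Omega> \<rho>) Q"
proof -
  interpret hyp: admissible_hypersurface M S \<Omega> U \<rho>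
    by unfold_locales (fact invertible_M boundary admissible)+
  interpret L2_projection "nu_measure M S \<rho>" L "tau M S \<rho>"
  proof
    show "L2_bounded_op (nu_measure M S \<rho>) (L2 (nu_measure M S \<rho>)) (L2 (nu_measure M S \<rho>)) L"
      using leray unfolding leray_L2_operator_def by blast
  qed (use lanzani_stein_projection hyp.tau_measurable hyp.tau_unimodular in auto)
  show ?thesis
    \<comment> \<open>The abstract results have target \<open>L2_range\<close>, which the range
      hypothesis identifies with the Hardy space.\<close>
    unfolding Let_def lanzani_stein_range[symmetric]
    using R_bounded Q_bounded Q_R opnorm_eq Q_invertible by blast
qed

end
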